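(* Let $0<\alpha<1$, let $\theta>0$ satisfy $\theta\,\|Dg_\alpha\|_\infty<1-\theta$, and let $f:\mathcal{M}\to\mathcal{M}$, $\mathcal{M}=[0,1]\times\mathbb{D}$, be the solenoid map with intermittency $f(x,z)=(g_\alpha(x),\,\theta z+\tfrac12 e^{2\pi i x})$. Let $X=\bigcap_{i\ge 0}f^i(\mathcal{M})$ be its attractor and $\mu=\mu_\alpha$ the SRB probability measure of $f$ on $X$. Let $H\subsetneq X$ be a measurable hole (connected or disconnected) with $\mu(H)\in(0,1)$, and suppose that $(\{0\}\times\mathbb{D})\cap\overline{H}=\emptyset$ and that $H$ has nonempty interior. Let $\tau_H(p):=\inf\{n\ge 1: f^n(p)\in H\}$. Then $$\mu(\tau_H>n)\approx n^{1-1/\alpha},$$ i.e. there is a constant $C\ge 1$ (independent of $n$) such that $C^{-1}n^{1-1/\alpha}\le \mu(\{p\in X:\tau_H(p)>n\})\le C\,n^{1-1/\alpha}$ for all integers $n\ge 1$.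
   Context: The Liverani–Saussol–Vaienti map $g_\alpha:[0,1]\to[0,1]$, $0<\alpha<1$, is defined by $g_\alpha(x)=x+2^{\alpha}x^{1+\alpha}$ for $0\le x\le \tfrac12$ and $g_\alpha(x)=2x-1$ for $\tfrac12<x\le 1$; $\|Dg_\alpha\|_\infty$ is the supremum of the derivative of $g_\alpha$ over its two branches. $\mathbb{D}\subset\mathbb{C}$ is the closed unit disk. It is known that there exists an SRB probability measure $\mu_\alpha$ on $X=\bigcap_{i\ge0}f^i(\mathcal{M})$: an $f$-invariant Borel probability measure on $X$ whose conditional measures on unstable manifolds are absolutely continuous with respect to Lebesgue measure on the unstable manifolds. $\overline{H}$ denotes the closure of $H$ in $\mathcal{M}$, and the interior of $H$ is taken relative to the phase space $X$. The first hitting time is $\tau_H(p)=\inf\{n\ge1: f^n(p)\in H\}$, with $\inf\emptyset=+\infty$. *)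

theory Defs
  imports "HOL-Probability.Probability"
begin

definition lsv :: "real \<Rightarrow> real \<Rightarrow> real" where
  "lsv \<alpha> x = (if x \<le> 1/2 then x + 2 powr \<alpha> * x powr (1 + \<alpha>) else 2 * x - 1)"

(* The branches are C^1 up to their endpoints, so the open branches give the same supremum
   as the closed ones with one-sided derivatives. *)
definition lsv_deriv_sup :: "real \<Rightarrow> real" where
  "lsv_deriv_sup \<alpha> = (SUP x \<in> {0<..<1/2} \<union> {1/2<..<1}. \<bar>deriv (lsv \<alpha>) x\<bar>)"

definition solenoid_domain :: "(real \<times> complex) set" where
  "solenoid_domain = {0..1} \<times> cball 0 1"

definition solenoid :: "real \<Rightarrow> real \<Rightarrow> real \<times> complex \<Rightarrow> real \<times> complex" where
  "solenoid \<alpha> \<theta> = (\<lambda>(x, z). (lsv \<alpha> x,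
     of_real \<theta> * z + 1/2 * exp (2 * of_real pi * \<i> * of_real x)))"

definition attractor :: "('a \<Rightarrow> 'a) \<Rightarrow> 'a set \<Rightarrow> 'a set" where
  "attractor f M = (\<Inter>i::nat. (f ^^ i) ` M)"

(* Backward orbits are given as sequences in X rather than through an inverse of f; the solenoid map
   is bijective on its attractor, so there each point has exactly one. *)
definition unstable_manifold :: "('a::metric_space \<Rightarrow> 'a) \<Rightarrow> 'a set \<Rightarrow> 'a \<Rightarrow> 'a set" where
  "unstable_manifold f X p = {q. \<exists>P Q :: nat \<Rightarrow> 'a.
     P 0 = p \<and> Q 0 = q \<and>
     (\<forall>n. P n \<in> X \<and> f (P (Suc n)) = P n) \<and>
     (\<forall>n. Q n \<in> X \<and> f (Q (Suc n)) = Q n) \<and>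
     (\<lambda>n. dist (P n) (Q n)) \<longlonglongrightarrow> 0}"

(* The unstable manifolds here are one-dimensional immersed C^1 manifolds.  Their submanifold
   topology and their Lebesgue measure class are described by the compact C^1 arcs they contain. *)
definition regular_arc :: "(real \<Rightarrow> 'a::euclidean_space) \<Rightarrow> bool" where
  "regular_arc \<gamma> \<longleftrightarrow> arc \<gamma> \<and> \<gamma> C1_differentiable_on {0..1} \<and>
     (\<forall>t\<in>{0..1}. vector_derivative \<gamma> (at t) \<noteq> 0)"

definition arc_length_measure :: "'a::euclidean_space set \<Rightarrow> (real \<Rightarrow> 'a) \<Rightarrow> 'a measure" where
  "arc_length_measure X \<gamma> =
     distr (density (restrict_space lborel {0..1}) (\<lambda>t. ennreal (norm (vector_derivative \<gamma> (at t)))))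
       (restrict_space borel X) \<gamma>"

(* A manifold W of dimension one, contained in X, is a countable union of compact C^1 arcs, so a
   set has Lebesgue measure zero in W iff it meets each such arc in a set of length zero. *)
definition leaf_null_sets :: "'a::euclidean_space set \<Rightarrow> 'a set \<Rightarrow> 'a set set" where
  "leaf_null_sets X W = {A \<in> sets (restrict_space borel X).
     \<forall>\<gamma>. regular_arc \<gamma> \<and> path_image \<gamma> \<subseteq> W \<longrightarrow> A \<in> null_sets (arc_length_measure X \<gamma>)}"

(* Element containing p of the partition of X generated by the sets E n; if they are measurable,
   this is a measurable partition in the sense of Rokhlin, and each one arises so modulo null sets. *)
definition partition_atom :: "'a set \<Rightarrow> (nat \<Rightarrow> 'a set) \<Rightarrow> 'a \<Rightarrow> 'a set" where
  "partition_atom X E p = {q \<in> X. \<forall>n. q \<in> E n \<longleftrightarrow> p \<in> E n}"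

definition measurable_partition :: "'a measure \<Rightarrow> ('a \<Rightarrow> 'a set) \<Rightarrow> bool" where
  "measurable_partition \<mu> \<xi> \<longleftrightarrow>
     (\<exists>E. (\<forall>n. E n \<in> sets \<mu>) \<and> (\<forall>p \<in> space \<mu>. \<xi> p = partition_atom (space \<mu>) E p))"

definition conditional_measures ::
    "'a measure \<Rightarrow> ('a \<Rightarrow> 'a set) \<Rightarrow> ('a \<Rightarrow> 'a measure) \<Rightarrow> bool" where
  "conditional_measures \<mu> \<xi> \<kappa> \<longleftrightarrow>
     \<kappa> \<in> \<mu> \<rightarrow>\<^sub>M prob_algebra \<mu> \<and>
     (\<forall>p \<in> space \<mu>. \<forall>q \<in> \<xi> p. \<kappa> q = \<kappa> p) \<and>
     (AE p in \<mu>. emeasure (\<kappa> p) (\<xi> p) = 1) \<and>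
     \<mu> \<bind> \<kappa> = \<mu>"

(* Subordinate in the sense of Ledrappier and Young: almost every element lies in an unstable
   manifold and contains a neighbourhood of p in its submanifold topology. *)
definition subordinate_to_unstable ::
    "('a::euclidean_space \<Rightarrow> 'a) \<Rightarrow> 'a set \<Rightarrow> 'a measure \<Rightarrow> ('a \<Rightarrow> 'a set) \<Rightarrow> bool" where
  "subordinate_to_unstable f X \<mu> \<xi> \<longleftrightarrow>
     (AE p in \<mu>. \<xi> p \<subseteq> unstable_manifold f X p \<and>
        (\<exists>\<gamma>. regular_arc \<gamma> \<and> p \<in> \<gamma> ` {0<..<1} \<and> path_image \<gamma> \<subseteq> \<xi> p))"

definition srb_measure ::
    "('a::euclidean_space \<Rightarrow> 'a) \<Rightarrow> 'a set \<Rightarrow> 'a measure \<Rightarrow> bool" where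
  "srb_measure f X \<mu> \<longleftrightarrow>
     sets \<mu> = sets (restrict_space borel X) \<and> prob_space \<mu> \<and>
     f \<in> \<mu> \<rightarrow>\<^sub>M \<mu> \<and> distr \<mu> \<mu> f = \<mu> \<and>
     (\<exists>\<xi> \<kappa>. measurable_partition \<mu> \<xi> \<and> subordinate_to_unstable f X \<mu> \<xi> \<and>
        conditional_measures \<mu> \<xi> \<kappa> \<and>
        (AE p in \<mu>. leaf_null_sets X (unstable_manifold f X p) \<subseteq> null_sets (\<kappa> p)))"

definition hitting_time :: "('a \<Rightarrow> 'a) \<Rightarrow> 'a set \<Rightarrow> 'a \<Rightarrow> enat" where
  "hitting_time f H p = Inf {enat n | n. 1 \<le> n \<and> (f ^^ n) p \<in> H}"

end

theory Submission
  imports Defs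
begin

text \<open>
  Both bounds reduce to statements about the interval map g, because the first coordinate of the
  solenoid map is g and the projection \<nu> of the SRB measure to the first coordinate is invariant
  under g.

  The measure \<nu> is absolutely continuous. A connected subset of the attractor has a single backward
  itinerary, since at each step the images of the two branches are separated; along it the second
  coordinate is therefore a Lipschitz function of the first (connected_lipschitz_graph). A regular
  arc in an unstable manifold is thus transversal to the fibres, so the fibres over a Lebesgue null
  set meet it in a set of length zero, and the conditional measures do not charge them
  (srb_projection).

  All quantitative information comes from one property of the inverse branches of the iterates of g,
  which is the invariant cone of Liverani, Saussol and Vaienti: the derivative D of each such branch
  is decreasing, while x powr (1 + \<alpha>) * D x is increasing (word_weight_cone). Hence every inverse
  branch has distortion at most 4 on Y = (1/2, 1], uniformly in the number of iterates. By the
  invariance of \<nu> and the approximation of its density by functions that are constant on cylinders,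
  \<nu> inherits the same distortion on Y (nu_distortion): there it is comparable to Lebesgue measure.

  Let a n denote the n-th preimage of 1 under the left branch (left_preimage n). It decays like n powr (-1/\<alpha>). By invariance,
  \<nu> (0, a n] is the sum over k \<ge> n of the measures of the part of Y that is sent to (0, a k], so it is of
  order n powr (1 - 1/\<alpha>). A point whose first coordinate is at most a (n + m) stays for n steps in the region
  over (0, a m], which the hole avoids for a suitable m; this is the lower bound.

  For the upper bound, the hole contains the image, under a fixed iterate, of the part of the
  attractor over a cylinder K contained in Y (hole_contains_cylinder_image), so it suffices to let
  orbits of g avoid K. Cut an orbit that starts in Y into blocks: a fixed number of arbitrary steps, then
  left steps until it returns to Y. With a conditional probability bounded away from 0 a block
  visits K, and it is longer than n only with a probability of order n powr (-1/\<alpha>); both follow from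
  bounded distortion. The resulting defective renewal inequality keeps the tail n powr (-1/\<alpha>)
  for orbits that start in Y (escape_tail). As in Kac's formula, the \<nu>-measure of the points that avoid K
  for n steps is the sum over m \<ge> n of the measures of the points of K that do not return to K for m steps,
  which raises the exponent by one (nu_escape_upper).
\<close>

section \<open>The left branch of the intermittent map\<close>
locale intermittent_map =
  fixes \<alpha> :: real
  assumes alpha_pos: "0 < \<alpha>" and alpha_less_1: "\<alpha> < 1"
begin

abbreviation g :: "real \<Rightarrow> real" where "g \<equiv> lsv \<alpha>"

text \<open>The formula makes sense on the whole half-line, where it defines an increasing bijection. Using it
there makes its inverse differentiable from both sides at the endpoint 1.\<close>
definition left_branch :: "real \<Rightarrow> real" where
  "left_branch x = x * (1 + (2 * x) powr \<alpha>)"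

definition left_inverse :: "real \<Rightarrow> real" where
  "left_inverse y = (SOME x. 0 \<le> x \<and> left_branch x = y)"

lemma left_branch_0 [simp]: "left_branch 0 = 0"
  and left_branch_half [simp]: "left_branch (1/2) = 1"
  by (simp_all add: left_branch_def)

lemma lsv_left: "g x = left_branch x" if "0 \<le> x" "x \<le> 1/2"
proof (cases "x = 0")
  case False
  then show ?thesis
    using that by (simp add: lsv_def left_branch_def powr_add powr_mult algebra_simps)
qed (simp add: lsv_def)

lemma lsv_right: "g x = 2 * x - 1" if "1/2 < x"
  using that by (simp add: lsv_def)

text \<open>An interval of length t that does not start at 0 is stretched at least as much as the interval from
0 to t. Cylinders therefore shrink at least as fast as those at the neutral fixed point.\<close>
lemma left_branch_superadditive:
  assumes "0 \<le> x" "x \<le> y"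
  shows "left_branch (y - x) \<le> left_branch y - left_branch x"
proof -
  have "x * (2 * x) powr \<alpha> \<le> x * (2 * y) powr \<alpha>"
    using assms alpha_pos by (intro mult_left_mono powr_mono2) auto
  moreover have "(y - x) * (2 * (y - x)) powr \<alpha> \<le> (y - x) * (2 * y) powr \<alpha>"
    using assms alpha_pos by (intro mult_left_mono powr_mono2) auto
  ultimately show ?thesis
    by (simp add: left_branch_def algebra_simps)
qed

lemma left_branch_ge: "x \<le> left_branch x" if "0 \<le> x"
  using that by (simp add: left_branch_def distrib_left)

lemma left_branch_expands: "y - x \<le> left_branch y - left_branch x" if "0 \<le> x" "x \<le> y"
  using left_branch_superadditive[OF that] left_branch_ge[of "y - x"] that by simp

lemma continuous_left_branch: "continuous_on {0..} left_branch"
  unfolding left_branch_def using alpha_pos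
  by (intro continuous_on_mult continuous_on_add continuous_on_const continuous_on_id
      continuous_on_powr') auto

lemma left_inverse:
  assumes "0 \<le> y"
  shows left_inverse_nonneg: "0 \<le> left_inverse y"
    and left_branch_inverse: "left_branch (left_inverse y) = y"
proof -
  have "\<exists>x\<ge>0. x \<le> y \<and> left_branch x = y"
    using assms left_branch_ge[of y]
    by (intro IVT') (auto intro: continuous_on_subset[OF continuous_left_branch])
  then have "\<exists>x. 0 \<le> x \<and> left_branch x = y" by blast
  from someI_ex[OF this] show "0 \<le> left_inverse y" "left_branch (left_inverse y) = y"
    unfolding left_inverse_def by auto
qed

lemma left_branch_strict_mono: "left_branch x < left_branch y" if "0 \<le> x" "x < y"
  using left_branch_expands[of x y] that by simp

lemma left_branch_le_iff: "left_branch x \<le> left_branch y \<longleftrightarrow> x \<le> y" if "0 \<le> x" "0 \<le> y"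
  using left_branch_strict_mono[of y x] left_branch_strict_mono[of x y] that
  by (cases x y rule: linorder_cases) auto

lemma left_inverse_branch: "left_inverse (left_branch x) = x" if "0 \<le> x"
proof -
  have "0 \<le> left_branch x" using left_branch_ge[OF that] that by simp
  then show ?thesis
    using left_branch_le_iff[of "left_inverse (left_branch x)" x]
      left_branch_le_iff[of x "left_inverse (left_branch x)"] left_inverse[of "left_branch x"] that
    by auto
qed

lemma left_inverse_0 [simp]: "left_inverse 0 = 0"
  and left_inverse_1 [simp]: "left_inverse 1 = 1/2"
  using left_inverse_branch[of 0] left_inverse_branch[of "1/2"] by auto

lemma left_inverse_le_iff: "left_inverse x \<le> left_inverse y \<longleftrightarrow> x \<le> y" if "0 \<le> x" "0 \<le> y"
  using that left_branch_le_iff[of "left_inverse x" "left_inverse y"] left_inverse by auto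

lemma left_inverse_less_iff: "left_inverse x < left_inverse y \<longleftrightarrow> x < y" if "0 \<le> x" "0 \<le> y"
  using left_inverse_le_iff[OF that(2,1)] by linarith

lemma left_inverse_le: "left_inverse x \<le> x" if "0 \<le> x"
  using left_branch_ge[of "left_inverse x"] left_inverse[OF that] by simp

lemma left_inverse_diff:
  assumes "0 \<le> x" "x \<le> y"
  shows "left_inverse y - left_inverse x \<le> left_inverse (y - x)"
proof -
  have le: "left_inverse x \<le> left_inverse y" using assms left_inverse_le_iff by simp
  have "left_branch (left_inverse y - left_inverse x) \<le> y - x"
    using left_branch_superadditive[of "left_inverse x" "left_inverse y"] left_inverse assms le by simp
  then show ?thesis
    using left_branch_le_iff[of "left_inverse y - left_inverse x" "left_inverse (y - x)"]
      left_inverse assms le by simp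
qed

lemma half_le_left_inverse: "t / 2 \<le> left_inverse t" if "0 \<le> t" "t \<le> 1"
proof -
  have "t powr \<alpha> \<le> 1" using that alpha_pos powr_mono2[of \<alpha> t 1] by simp
  then have "left_branch (t / 2) \<le> t"
    using that mult_left_mono[of "t powr \<alpha>" 1 t] by (simp add: left_branch_def algebra_simps)
  then show ?thesis
    using left_branch_le_iff[of "t / 2" "left_inverse t"] left_inverse that by simp
qed

definition left_deriv :: "real \<Rightarrow> real" where
  "left_deriv x = 1 + (1 + \<alpha>) * (2 * x) powr \<alpha>"

lemma left_deriv_ge_1: "1 \<le> left_deriv x"
  using alpha_pos by (simp add: left_deriv_def)

lemma left_branch_deriv: "(left_branch has_real_derivative left_deriv x) (at x)" if "0 < x"
proof -
  have "((\<lambda>x. x + 2 powr \<alpha> * x powr (1 + \<alpha>)) has_real_derivative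
      1 + 2 powr \<alpha> * ((1 + \<alpha>) * x powr (1 + \<alpha> - 1))) (at x)"
    using that by (intro DERIV_add DERIV_ident DERIV_cmult has_real_derivative_powr)
  also have "1 + 2 powr \<alpha> * ((1 + \<alpha>) * x powr (1 + \<alpha> - 1)) = left_deriv x"
    using that by (simp add: left_deriv_def powr_mult algebra_simps)
  finally show ?thesis
  proof (rule has_field_derivative_transform_within_open[where S="{0<..}"])
    fix y :: real assume "y \<in> {0<..}"
    then show "y + 2 powr \<alpha> * y powr (1 + \<alpha>) = left_branch y"
      by (simp add: left_branch_def powr_add powr_mult algebra_simps)
  qed (use that in auto)
qed

lemma left_inverse_pos: "0 < left_inverse x" if "0 < x"
  using left_inverse_less_iff[of 0 x] that by simp

lemma left_inverse_lipschitz: "\<bar>left_inverse x - left_inverse y\<bar> \<le> left_inverse \<bar>x - y\<bar>"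
  if "0 \<le> x" "0 \<le> y"
  using that left_inverse_diff[of x y] left_inverse_diff[of y x] left_inverse_le_iff[of x y] left_inverse_le_iff[of y x]
  by (cases "x \<le> y") auto

lemma left_inverse_isCont: "isCont left_inverse x" if "0 < x"
proof -
  have "1-lipschitz_on {0..} left_inverse"
  proof (rule lipschitz_onI)
    fix x y :: real assume "x \<in> {0..}" "y \<in> {0..}"
    then show "dist (left_inverse x) (left_inverse y) \<le> 1 * dist x y"
      using left_inverse_lipschitz[of x y] left_inverse_le[of "\<bar>x - y\<bar>"]
      by (simp add: dist_real_def)
  qed simp
  then have "continuous_on {0..} left_inverse" by (rule lipschitz_on_continuous_on)
  then show ?thesis
    using that by (simp add: continuous_on_interior)
qed

lemma left_inverse_deriv:
  assumes "0 < x"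
  shows "(left_inverse has_real_derivative 1 / left_deriv (left_inverse x)) (at x)"
proof -
  have "(left_inverse has_real_derivative inverse (left_deriv (left_inverse x))) (at x)"
  proof (rule DERIV_inverse_function[where f=left_branch and a=0 and b="x+1"])
    show "DERIV left_branch (left_inverse x) :> left_deriv (left_inverse x)"
      using left_branch_deriv left_inverse_pos assms by simp
    show "left_deriv (left_inverse x) \<noteq> 0" using left_deriv_ge_1[of "left_inverse x"] by simp
  qed (use assms left_inverse left_inverse_isCont in auto)
  then show ?thesis by (simp add: inverse_eq_divide)
qed

text \<open>The right branch alone forces the contraction rate of the solenoid map to be less than 1/3.\<close>
lemma lsv_deriv_sup_ge_2: "2 \<le> lsv_deriv_sup \<alpha>"
proof -
  have right: "deriv g x = 2" if "1/2 < x" for x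
  proof (rule DERIV_imp_deriv)
    have "((\<lambda>x. 2 * x - 1) has_real_derivative 2) (at x)" by (auto intro!: derivative_eq_intros)
    then show "(g has_real_derivative 2) (at x)"
      by (rule has_field_derivative_transform_within_open[of _ _ _ "{1/2<..}"]) (use that lsv_right in auto)
  qed
  have left: "deriv g x = left_deriv x" if "0 < x" "x < 1/2" for x
  proof (rule DERIV_imp_deriv)
    show "(g has_real_derivative left_deriv x) (at x)"
      by (rule has_field_derivative_transform_within_open[OF left_branch_deriv, of _ "{0<..<1/2}"])
        (use that lsv_left in auto)
  qed
  have "\<bar>deriv g x\<bar> \<le> 3" if "x \<in> {0<..<1/2} \<union> {1/2<..<1}" for x
  proof (cases "x < 1/2")
    case True
    then have x: "0 < x" "x < 1/2" using that by auto
    have "(2 * x) powr \<alpha> \<le> 1" using powr_mono2[of \<alpha> "2 * x" 1] x alpha_pos by simp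
    then have "(1 + \<alpha>) * (2 * x) powr \<alpha> \<le> 2 * 1"
      using alpha_less_1 alpha_pos by (intro mult_mono) auto
    then show ?thesis using left[OF x] left_deriv_ge_1[of x] by (simp add: left_deriv_def)
  next
    case False
    then show ?thesis using that right[of x] by auto
  qed
  then have "bdd_above ((\<lambda>x. \<bar>deriv g x\<bar>) ` ({0<..<1/2} \<union> {1/2<..<1}))"
    by (intro bdd_aboveI[of _ 3]) auto
  then have "\<bar>deriv g (3/4)\<bar> \<le> lsv_deriv_sup \<alpha>"
    unfolding lsv_deriv_sup_def by (intro cSUP_upper) auto
  then show ?thesis using right[of "3/4"] by simp
qed

section \<open>Inverse branches of the iterates\<close>
text \<open>Words over the two branches, where True stands for the right one, index the inverse branches of the
iterates. The first letter of a word is the branch that is applied first to a point of the cylinder.\<close>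
definition branch_inverse :: "bool \<Rightarrow> real \<Rightarrow> real" where
  "branch_inverse b x = (if b then (1 + x) / 2 else left_inverse x)"

definition branch_weight :: "bool \<Rightarrow> real \<Rightarrow> real" where
  "branch_weight b x = (if b then 1 / 2 else 1 / left_deriv (left_inverse x))"

primrec word_inverse :: "bool list \<Rightarrow> real \<Rightarrow> real" where
  "word_inverse [] x = x"
| "word_inverse (b # w) x = branch_inverse b (word_inverse w x)"

primrec word_weight :: "bool list \<Rightarrow> real \<Rightarrow> real" where
  "word_weight [] x = 1"
| "word_weight (b # w) x = branch_weight b (word_inverse w x) * word_weight w x"

primrec itinerary :: "nat \<Rightarrow> real \<Rightarrow> bool list" where
  "itinerary 0 x = []"
| "itinerary (Suc n) x = (1/2 < x) # itinerary n (g x)"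

lemma length_itinerary [simp]: "length (itinerary n x) = n"
  by (induction n arbitrary: x) auto

lemma word_inverse_append: "word_inverse (v @ w) x = word_inverse v (word_inverse w x)"
  by (induction v) auto

lemma word_weight_append:
  "word_weight (v @ w) x = word_weight v (word_inverse w x) * word_weight w x"
  by (induction v) (auto simp: word_inverse_append)

lemma branch_inverse_pos: "0 < x \<Longrightarrow> 0 < branch_inverse b x"
  by (simp add: branch_inverse_def left_inverse_pos)

lemma branch_inverse_nonneg: "0 \<le> x \<Longrightarrow> 0 \<le> branch_inverse b x"
  by (simp add: branch_inverse_def left_inverse)

lemma branch_inverse_le_1: "0 \<le> x \<Longrightarrow> x \<le> 1 \<Longrightarrow> branch_inverse b x \<le> 1"
  using left_inverse_le[of x] by (simp add: branch_inverse_def)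

lemma branch_inverse_less_iff:
  "0 \<le> x \<Longrightarrow> 0 \<le> y \<Longrightarrow> branch_inverse b x < branch_inverse b y \<longleftrightarrow> x < y"
  by (simp add: branch_inverse_def left_inverse_less_iff)

lemma word_inverse_pos: "0 < x \<Longrightarrow> 0 < word_inverse w x"
  by (induction w) (auto simp: branch_inverse_pos)

lemma word_inverse_nonneg: "0 \<le> x \<Longrightarrow> 0 \<le> word_inverse w x"
  by (induction w) (auto simp: branch_inverse_nonneg)

lemma word_inverse_le_1: "0 \<le> x \<Longrightarrow> x \<le> 1 \<Longrightarrow> word_inverse w x \<le> 1"
  by (induction w) (auto simp: branch_inverse_le_1 word_inverse_nonneg)

lemma word_inverse_less_iff:
  "0 \<le> x \<Longrightarrow> 0 \<le> y \<Longrightarrow> word_inverse w x < word_inverse w y \<longleftrightarrow> x < y"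
  by (induction w) (auto simp: branch_inverse_less_iff word_inverse_nonneg)

lemma word_inverse_le_iff:
  "0 \<le> x \<Longrightarrow> 0 \<le> y \<Longrightarrow> word_inverse w x \<le> word_inverse w y \<longleftrightarrow> x \<le> y"
  using word_inverse_less_iff[of y x w] by linarith

lemma g_branch_inverse:
  assumes "0 < x" "x \<le> 1"
  shows "g (branch_inverse b x) = x" and "1/2 < branch_inverse b x \<longleftrightarrow> b"
proof -
  have "left_inverse x \<le> 1/2" using left_inverse_le_iff[of x 1] assms by simp
  then show "g (branch_inverse b x) = x" "1/2 < branch_inverse b x \<longleftrightarrow> b"
    using lsv_left[of "left_inverse x"] left_inverse[of x] lsv_right[of "(1 + x) / 2"] assms
    by (auto simp: branch_inverse_def field_simps)
qed

lemma itinerary_word_inverse: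
  assumes "0 < x" "x \<le> 1"
  shows "(g ^^ length w) (word_inverse w x) = x" "itinerary (length w) (word_inverse w x) = w"
proof (induction w)
  case (Cons b w)
  {
    case 1
    then show ?case
      using Cons g_branch_inverse(1)[of "word_inverse w x" b] assms
      by (simp add: funpow_swap1 word_inverse_pos word_inverse_le_1)
  next
    case 2
    then show ?case
      using Cons g_branch_inverse[of "word_inverse w x" b] assms
      by (simp add: word_inverse_pos word_inverse_le_1)
  }
qed auto

lemma branch_inverse_g:
  assumes "0 \<le> y" "y \<le> 1" shows "branch_inverse (1/2 < y) (g y) = y"
  using assms lsv_left[of y] lsv_right[of y] left_inverse_branch[of y]
  by (cases "1/2 < y") (auto simp: branch_inverse_def)

lemma g_unit: "0 \<le> y \<Longrightarrow> y \<le> 1 \<Longrightarrow> 0 \<le> g y \<and> g y \<le> 1"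
  using lsv_left[of y] lsv_right[of y] left_branch_le_iff[of y "1/2"] left_branch_le_iff[of 0 y]
  by (cases "1/2 < y") auto

lemma g_pos: "0 < y \<Longrightarrow> y \<le> 1 \<Longrightarrow> 0 < g y"
  using lsv_left[of y] lsv_right[of y] left_branch_strict_mono[of 0 y]
  by (cases "1/2 < y") auto

lemma g_funpow_unit: "0 \<le> y \<Longrightarrow> y \<le> 1 \<Longrightarrow> 0 \<le> (g ^^ n) y \<and> (g ^^ n) y \<le> 1"
  by (induction n) (auto simp: g_unit)

lemma g_funpow_pos: "0 < y \<Longrightarrow> y \<le> 1 \<Longrightarrow> 0 < (g ^^ n) y"
  using g_funpow_unit[of y] by (induction n) (auto simp: g_pos)

lemma word_inverse_itinerary:
  "0 \<le> y \<Longrightarrow> y \<le> 1 \<Longrightarrow> word_inverse (itinerary n y) ((g ^^ n) y) = y"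
proof (induction n arbitrary: y)
  case (Suc n)
  then show ?case using g_unit[of y] branch_inverse_g[of y] by (simp add: funpow_swap1)
qed simp

text \<open>These are the endpoints of the intervals with a given number of left steps before the entry into
(1/2, 1].\<close>
definition left_preimage :: "nat \<Rightarrow> real" where
  "left_preimage n = (left_inverse ^^ n) 1"

lemma left_preimage_0 [simp]: "left_preimage 0 = 1" by (simp add: left_preimage_def)

lemma left_preimage_Suc: "left_preimage (Suc n) = left_inverse (left_preimage n)"
  by (simp add: left_preimage_def)

lemma left_preimage_pos: "0 < left_preimage n"
  by (induction n) (auto simp: left_preimage_Suc left_inverse_pos)

lemma left_preimage_Suc_le: "left_preimage (Suc n) \<le> left_preimage n"
  using left_preimage_pos[of n] by (simp add: left_preimage_Suc left_inverse_le)

lemma left_preimage_antimono: "m \<le> n \<Longrightarrow> left_preimage n \<le> left_preimage m"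
  by (rule lift_Suc_antimono_le[of left_preimage, OF left_preimage_Suc_le])

lemma left_preimage_le_1: "left_preimage n \<le> 1"
  using left_preimage_antimono[of 0 n] by simp

lemma left_word_inverse:
  "word_inverse (replicate k False) (left_preimage j) = left_preimage (k + j)"
  by (induction k) (auto simp: left_preimage_Suc branch_inverse_def)

lemma branch_inverse_contracts:
  assumes "0 \<le> x" "x \<le> 1" "0 \<le> y" "y \<le> 1"
  shows "\<bar>branch_inverse b x - branch_inverse b y\<bar> \<le> left_inverse \<bar>x - y\<bar>"
  using assms left_inverse_lipschitz[of x y] half_le_left_inverse[of "\<bar>x - y\<bar>"]
  by (auto simp: branch_inverse_def diff_divide_distrib[symmetric])

text \<open>Each branch inverse maps an interval of length t to one no longer than the left inverse of t:
for the left branch this is superadditivity, for the right branch it is t / 2 \<le> left_inverse t.\<close>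
lemma word_inverse_contracts:
  assumes "0 \<le> x" "x \<le> 1" "0 \<le> y" "y \<le> 1"
  shows word_inverse_diameter: "\<bar>word_inverse w x - word_inverse w y\<bar> \<le> left_preimage (length w)"
    and word_inverse_lipschitz: "\<bar>word_inverse w x - word_inverse w y\<bar> \<le> \<bar>x - y\<bar>"
proof -
  have "\<bar>word_inverse w x - word_inverse w y\<bar> \<le> left_preimage (length w) \<and>
        \<bar>word_inverse w x - word_inverse w y\<bar> \<le> \<bar>x - y\<bar>"
  proof (induction w)
    case (Cons b w)
    let ?d = "\<bar>word_inverse w x - word_inverse w y\<bar>"
    have "\<bar>word_inverse (b # w) x - word_inverse (b # w) y\<bar> \<le> left_inverse ?d"
      using branch_inverse_contracts word_inverse_nonneg word_inverse_le_1 assms by simp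
    moreover have "left_inverse ?d \<le> left_preimage (length (b # w))"
      using Cons left_inverse_le_iff[of ?d "left_preimage (length w)"] left_preimage_pos[of "length w"]
      by (simp add: left_preimage_Suc)
    moreover have "left_inverse ?d \<le> ?d" by (rule left_inverse_le) simp
    ultimately show ?case using Cons by linarith
  qed (use assms in auto)
  then show "\<bar>word_inverse w x - word_inverse w y\<bar> \<le> left_preimage (length w)"
    "\<bar>word_inverse w x - word_inverse w y\<bar> \<le> \<bar>x - y\<bar>" by auto
qed

lemma branch_inverse_deriv: "0 < x \<Longrightarrow> (branch_inverse b has_real_derivative branch_weight b x) (at x)"
proof (cases b)
  case True
  have "((\<lambda>x. (1 + x) / 2) has_real_derivative 1 / 2) (at x)"
    by (auto intro!: derivative_eq_intros)
  then show ?thesis using True by (simp add: branch_inverse_def [abs_def] branch_weight_def)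
next
  case False
  assume "0 < x"
  then show ?thesis using left_inverse_deriv[of x] False
    by (simp add: branch_inverse_def [abs_def] branch_weight_def)
qed

lemma word_inverse_deriv: "0 < x \<Longrightarrow> (word_inverse w has_real_derivative word_weight w x) (at x)"
proof (induction w)
  case Nil
  then show ?case by (simp add: word_inverse_def [abs_def])
next
  case (Cons b w)
  then show ?case
    using DERIV_chain[where f="branch_inverse b" and g="word_inverse w" and x=x,
        OF branch_inverse_deriv]
    by (simp add: word_inverse_pos o_def)
qed

lemma continuous_word_inverse: "continuous_on {0..1} (word_inverse w)"
proof -
  have "1-lipschitz_on {0..1} (word_inverse w)"
    using word_inverse_lipschitz by (intro lipschitz_onI) (auto simp: dist_real_def)
  then show ?thesis by (rule lipschitz_on_continuous_on)
qed

lemma word_inverse_image: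
  assumes "0 \<le> a" "a \<le> b" "b \<le> 1"
  shows "word_inverse w ` {a<..b} = {word_inverse w a<..word_inverse w b}"
proof (intro equalityI subsetI)
  fix y assume y: "y \<in> {word_inverse w a<..word_inverse w b}"
  then have "\<exists>x\<ge>a. x \<le> b \<and> word_inverse w x = y"
    using assms by (intro IVT') (auto intro: continuous_on_subset[OF continuous_word_inverse])
  then obtain x where "a \<le> x" "x \<le> b" "word_inverse w x = y" by auto
  with y show "y \<in> word_inverse w ` {a<..b}" by (cases "x = a") auto
qed (use assms word_inverse_less_iff word_inverse_le_iff in auto)

section \<open>Bounded distortion of the inverse branches\<close>
lemma branch_weight_pos: "0 < branch_weight b x"
  using left_deriv_ge_1[of "left_inverse x"] by (simp add: branch_weight_def)

lemma word_weight_pos: "0 < word_weight w x"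
  by (induction w) (auto simp: branch_weight_pos)

lemma branch_weight_antimono: "0 < x \<Longrightarrow> x \<le> y \<Longrightarrow> branch_weight b y \<le> branch_weight b x"
proof -
  assume *: "0 < x" "x \<le> y"
  have "0 < left_inverse x" "left_inverse x \<le> left_inverse y"
    using * left_inverse_pos left_inverse_le_iff by auto
  then have "left_deriv (left_inverse x) \<le> left_deriv (left_inverse y)"
    using alpha_pos unfolding left_deriv_def by (intro add_mono mult_left_mono powr_mono2) auto
  then show ?thesis
    using left_deriv_ge_1[of "left_inverse x"] by (auto simp: branch_weight_def intro: divide_left_mono)
qed

text \<open>With s = (2 u) powr \<alpha> and u the left inverse of x, this quotient is (x / u) powr (1 + \<alpha>) times the
derivative of the left inverse.\<close>
lemma power_quotient_mono:
  assumes "0 \<le> s" "s \<le> t"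
  shows "(1 + s) powr (1 + \<alpha>) / (1 + (1 + \<alpha>) * s) \<le> (1 + t) powr (1 + \<alpha>) / (1 + (1 + \<alpha>) * t)"
proof (rule DERIV_nonneg_imp_nondecreasing[OF assms(2)])
  fix x assume x: "s \<le> x" "x \<le> t"
  let ?D = "((1 + \<alpha>) * (1 + x) powr \<alpha> * (1 + (1 + \<alpha>) * x) - (1 + x) powr (1 + \<alpha>) * (1 + \<alpha>))
      / (1 + (1 + \<alpha>) * x)\<^sup>2"
  have pos: "1 + (1 + \<alpha>) * x > 0" using x assms alpha_pos by (simp add: add_pos_nonneg)
  have "((\<lambda>x. (1 + x) powr (1 + \<alpha>)) has_real_derivative (1 + \<alpha>) * (1 + x) powr \<alpha>) (at x)"
    using DERIV_fun_powr[of "\<lambda>x. 1 + x" 1 x "1 + \<alpha>"] x assms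
    by (auto intro!: derivative_eq_intros)
  moreover have "((\<lambda>x. 1 + (1 + \<alpha>) * x) has_real_derivative 1 + \<alpha>) (at x)"
    by (auto intro!: derivative_eq_intros)
  ultimately have "((\<lambda>x. (1 + x) powr (1 + \<alpha>) / (1 + (1 + \<alpha>) * x)) has_real_derivative ?D) (at x)"
    using pos DERIV_divide[of "\<lambda>x. (1 + x) powr (1 + \<alpha>)" "(1 + \<alpha>) * (1 + x) powr \<alpha>" x UNIV
        "\<lambda>x. 1 + (1 + \<alpha>) * x" "1 + \<alpha>"]
    by (simp add: power2_eq_square)
  moreover have "?D = (1 + \<alpha>) * (1 + x) powr \<alpha> * (\<alpha> * x) / (1 + (1 + \<alpha>) * x)\<^sup>2"
    using x assms by (simp add: powr_add algebra_simps)
  moreover have "0 \<le> (1 + \<alpha>) * (1 + x) powr \<alpha> * (\<alpha> * x) / (1 + (1 + \<alpha>) * x)\<^sup>2"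
    using x assms alpha_pos by simp
  ultimately show "\<exists>y. ((\<lambda>x. (1 + x) powr (1 + \<alpha>) / (1 + (1 + \<alpha>) * x)) has_real_derivative y) (at x) \<and> 0 \<le> y"
    by metis
qed

lemma branch_weight_growth:
  assumes "0 < x" "x \<le> y"
  shows "(x / branch_inverse b x) powr (1 + \<alpha>) * branch_weight b x
       \<le> (y / branch_inverse b y) powr (1 + \<alpha>) * branch_weight b y"
proof (cases b)
  case True
  have "2 * x / (1 + x) \<le> 2 * y / (1 + y)" using assms by (simp add: field_simps)
  then have "(2 * x / (1 + x)) powr (1 + \<alpha>) \<le> (2 * y / (1 + y)) powr (1 + \<alpha>)"
    using assms alpha_pos by (intro powr_mono2) auto
  then show ?thesis using True by (simp add: branch_inverse_def branch_weight_def mult.commute)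
next
  case False
  have eq: "(x / branch_inverse b x) powr (1 + \<alpha>) * branch_weight b x =
     (1 + (2 * left_inverse x) powr \<alpha>) powr (1 + \<alpha>) / (1 + (1 + \<alpha>) * (2 * left_inverse x) powr \<alpha>)"
    if "0 < x" for x
  proof -
    have "x = left_inverse x * (1 + (2 * left_inverse x) powr \<alpha>)"
      using left_inverse(2)[of x] that by (simp add: left_branch_def)
    then have "x / left_inverse x = 1 + (2 * left_inverse x) powr \<alpha>"
      using left_inverse_pos[OF that] by (simp add: field_simps)
    then show ?thesis using False by (simp add: branch_inverse_def branch_weight_def left_deriv_def)
  qed
  have "(2 * left_inverse x) powr \<alpha> \<le> (2 * left_inverse y) powr \<alpha>"
    using assms alpha_pos left_inverse_pos[of x] left_inverse_le_iff[of x y] by (intro powr_mono2) auto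
  then show ?thesis using eq[of x] eq[of y] assms power_quotient_mono by simp
qed

text \<open>Both monotonicity properties survive composition with one more inverse branch on the inside: the
first because the derivatives of the branch inverses decrease, the second by
branch_weight_growth. Appending letters at the end of the word is hence the right induction.\<close>
lemma word_weight_cone:
  assumes "0 < x" "x \<le> y"
  shows word_weight_antimono: "word_weight w y \<le> word_weight w x"
    and word_weight_growth: "x powr (1 + \<alpha>) * word_weight w x \<le> y powr (1 + \<alpha>) * word_weight w y"
proof -
  have "word_weight w y \<le> word_weight w x \<and>
    x powr (1 + \<alpha>) * word_weight w x \<le> y powr (1 + \<alpha>) * word_weight w y"
    using assms
  proof (induction w arbitrary: x y rule: rev_induct)
    case Nil
    then show ?case using alpha_pos by (auto intro: powr_mono2)
  next
    case (snoc b w)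
    let ?p = "branch_inverse b"
    have p: "0 < ?p x" "?p x \<le> ?p y"
      using snoc.prems branch_inverse_pos branch_inverse_less_iff[of y x b] by (auto simp: not_less[symmetric])
    note IH = snoc.IH[OF p]
    have "word_weight w (?p y) * branch_weight b y \<le> word_weight w (?p x) * branch_weight b x"
      using IH branch_weight_antimono[OF snoc.prems] branch_weight_pos word_weight_pos
      by (intro mult_mono) (auto intro: less_imp_le)
    moreover
    have eq: "x powr (1 + \<alpha>) * (word_weight w (?p x) * branch_weight b x) =
        (?p x powr (1 + \<alpha>) * word_weight w (?p x)) * ((x / ?p x) powr (1 + \<alpha>) * branch_weight b x)"
      if "0 < x" for x
      using that branch_inverse_pos[OF that, of b] by (simp add: powr_divide)
    have "(?p x powr (1 + \<alpha>) * word_weight w (?p x)) * ((x / ?p x) powr (1 + \<alpha>) * branch_weight b x)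
       \<le> (?p y powr (1 + \<alpha>) * word_weight w (?p y)) * ((y / ?p y) powr (1 + \<alpha>) * branch_weight b y)"
      using IH branch_weight_growth[OF snoc.prems, of b] less_imp_le[OF branch_weight_pos]
        less_imp_le[OF word_weight_pos]
      by (rule_tac mult_mono) auto
    moreover have "word_weight (w @ [b]) x = word_weight w (?p x) * branch_weight b x" for x
      by (simp add: word_weight_append)
    moreover have "0 < y" using snoc.prems by simp
    ultimately show ?case using eq[OF snoc.prems(1)] eq[OF \<open>0 < y\<close>] by presburger
  qed
  then show "word_weight w y \<le> word_weight w x"
    "x powr (1 + \<alpha>) * word_weight w x \<le> y powr (1 + \<alpha>) * word_weight w y" by auto
qed

text \<open>Only the distance to 0 matters: the quotient of two values of a decreasing weight with
x powr (1 + \<alpha>) * D x increasing is at most 2 powr (1 + \<alpha>) on [1/2, 1].\<close>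
lemma word_weight_distortion:
  assumes "1/2 \<le> x" "x \<le> 1"
  shows "word_weight w 1 \<le> word_weight w x" "word_weight w x \<le> 4 * word_weight w 1"
proof -
  show "word_weight w 1 \<le> word_weight w x" using assms word_weight_antimono by simp
  have "(1/4::real) = (1/2) powr 2" by (simp add: powr_numeral power2_eq_square)
  also have "\<dots> \<le> (1/2) powr (1 + \<alpha>)" using alpha_less_1 by (intro powr_mono') auto
  also have "\<dots> \<le> x powr (1 + \<alpha>)" using assms alpha_pos by (intro powr_mono2) auto
  finally have "1/4 * word_weight w x \<le> x powr (1 + \<alpha>) * word_weight w x"
    using word_weight_pos[of w x] by (intro mult_right_mono) auto
  also have "\<dots> \<le> 1 powr (1 + \<alpha>) * word_weight w 1"
    using assms by (intro word_weight_growth) auto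
  finally show "word_weight w x \<le> 4 * word_weight w 1" by simp
qed

lemma word_inverse_increment:
  assumes "1/2 \<le> x" "x \<le> y" "y \<le> 1"
  shows "word_weight w 1 * (y - x) \<le> word_inverse w y - word_inverse w x"
    and "word_inverse w y - word_inverse w x \<le> 4 * word_weight w 1 * (y - x)"
proof -
  have "word_weight w 1 * (y - x) \<le> word_inverse w y - word_inverse w x \<and>
     word_inverse w y - word_inverse w x \<le> 4 * word_weight w 1 * (y - x)"
  proof (cases "x = y")
    case False
    then have "\<exists>z. x < z \<and> z < y \<and> word_inverse w y - word_inverse w x = (y - x) * word_weight w z"
      using assms by (intro MVT2) (auto intro: word_inverse_deriv)
    then obtain z where z: "x < z" "z < y"
      "word_inverse w y - word_inverse w x = (y - x) * word_weight w z" by auto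
    have "word_weight w 1 * (y - x) \<le> word_weight w z * (y - x)"
      "word_weight w z * (y - x) \<le> 4 * word_weight w 1 * (y - x)"
      using z assms by (auto intro!: mult_right_mono word_weight_distortion)
    then show ?thesis using z(3) by (simp add: mult.commute)
  qed simp
  then show "word_weight w 1 * (y - x) \<le> word_inverse w y - word_inverse w x"
    "word_inverse w y - word_inverse w x \<le> 4 * word_weight w 1 * (y - x)" by auto
qed

section \<open>Decay of the preimages of 1 under the left branch\<close>
lemma left_preimage_recursion:
  obtains y where "0 < y" "y \<le> 1" "left_preimage n = left_preimage (Suc n) * (1 + y)"
    "y = 2 powr \<alpha> * left_preimage (Suc n) powr \<alpha>"
proof
  let ?x = "left_preimage (Suc n)"
  have "?x \<le> 1/2"
    using left_preimage_antimono[of 1 "Suc n"] by (simp add: left_preimage_Suc)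
  then have "(2 * ?x) powr \<alpha> \<le> 1 powr \<alpha>"
    using alpha_pos left_preimage_pos[of "Suc n"] by (intro powr_mono2) auto
  then show "2 powr \<alpha> * ?x powr \<alpha> \<le> 1"
    using left_preimage_pos[of "Suc n"] by (simp add: powr_mult)
  show "0 < 2 powr \<alpha> * ?x powr \<alpha>" using left_preimage_pos[of "Suc n"] by simp
  have "left_preimage n = left_branch ?x"
    using left_inverse(2)[of "left_preimage n"] left_preimage_pos[of n] by (simp add: left_preimage_Suc)
  then show "left_preimage n = ?x * (1 + 2 powr \<alpha> * ?x powr \<alpha>)"
    using left_preimage_pos[of "Suc n"] by (simp add: left_branch_def powr_mult)
qed simp

text \<open>In the coordinate s = x powr (-\<alpha>) the left branch is close to a translation: one step back changes s by
an amount between two positive constants.\<close>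
lemma left_preimage_powr_bounds:
  "1 + real n * (\<alpha> / 2) \<le> left_preimage n powr (-\<alpha>) \<and> left_preimage n powr (-\<alpha>) \<le> 1 + 2 * real n"
proof (induction n)
  case (Suc n)
  obtain y where y: "0 < y" "y \<le> 1" "left_preimage n = left_preimage (Suc n) * (1 + y)"
    "y = 2 powr \<alpha> * left_preimage (Suc n) powr \<alpha>"
    by (rule left_preimage_recursion)
  let ?s = "left_preimage n powr (-\<alpha>)" and ?t = "left_preimage (Suc n) powr (-\<alpha>)"
  have pos: "0 < left_preimage (Suc n)" by (rule left_preimage_pos)
  have ty: "?t * y = 2 powr \<alpha>"
    using pos by (simp add: y(4) powr_minus)
  have s: "?s = ?t * (1 + y) powr (-\<alpha>)"
    using y(1) pos by (subst y(3)) (simp add: powr_mult)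
  then have t: "?t = ?s * (1 + y) powr \<alpha>"
    using y(1) by (simp add: powr_minus field_simps)
  have two: "2 powr \<alpha> \<le> 2"
    using powr_mono[of \<alpha> 1 2] alpha_less_1 by simp
  have "1 + \<alpha> * (y / 2) \<le> (1 + y) powr \<alpha>"
  proof -
    have "ln (1 / (1 + y)) \<le> 1 / (1 + y) - 1" using y by (intro ln_le_minus_one) auto
    then have "1 - 1 / (1 + y) \<le> ln (1 + y)" using y by (simp add: ln_div)
    moreover have "y / 2 \<le> 1 - 1 / (1 + y)"
      using y mult_left_mono[of y 1 y] by (simp add: field_simps)
    ultimately have "\<alpha> * (y / 2) \<le> \<alpha> * ln (1 + y)"
      using alpha_pos by (intro mult_left_mono) auto
    then have "1 + \<alpha> * (y / 2) \<le> exp (\<alpha> * ln (1 + y))"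
      using exp_ge_add_one_self[of "\<alpha> * ln (1 + y)"] by linarith
    then show ?thesis using y by (simp add: powr_def)
  qed
  then have "?s * (1 + \<alpha> * (y / 2)) \<le> ?t"
    using t by (metis mult_left_mono powr_ge_zero)
  moreover have "1 \<le> ?s * y"
  proof -
    have "?s * y = 2 powr \<alpha> * (1 + y) powr (-\<alpha>)" using s ty by (simp add: mult_ac)
    also have "\<dots> = (2 / (1 + y)) powr \<alpha>"
      using y by (simp add: powr_divide powr_minus field_simps)
    finally show ?thesis
      using y alpha_pos powr_mono2[of \<alpha> 1 "2 / (1 + y)"] by simp
  qed
  then have "\<alpha> / 2 * 1 \<le> \<alpha> / 2 * (?s * y)"
    using alpha_pos by (intro mult_left_mono) auto
  ultimately have lower: "?s + \<alpha> / 2 \<le> ?t" by (simp add: algebra_simps)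
  have "1 - \<alpha> * y \<le> (1 + y) powr (-\<alpha>)"
  proof -
    have "\<alpha> * ln (1 + y) \<le> \<alpha> * y"
      using y alpha_pos ln_add_one_self_le_self[of y] by (intro mult_left_mono) auto
    then have "1 - \<alpha> * y \<le> exp (- \<alpha> * ln (1 + y))"
      using exp_ge_add_one_self[of "- \<alpha> * ln (1 + y)"] by simp
    then show ?thesis using y by (simp add: powr_def)
  qed
  then have "?t * (1 - \<alpha> * y) \<le> ?s"
    using s by (metis mult_left_mono powr_ge_zero)
  then have "?t - \<alpha> * 2 powr \<alpha> \<le> ?s"
    using ty by (simp add: algebra_simps)
  moreover have "\<alpha> * 2 powr \<alpha> \<le> 1 * 2"
    using alpha_pos alpha_less_1 two by (intro mult_mono) auto
  ultimately have "?t \<le> ?s + 2" by linarith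
  with lower Suc show ?case by (simp add: algebra_simps add_divide_distrib)
qed simp

lemma left_preimage_bounds:
  assumes "1 \<le> n"
  shows left_preimage_upper: "left_preimage n \<le> (2 / \<alpha>) powr (1/\<alpha>) * real n powr (- (1/\<alpha>))"
    and left_preimage_lower: "(1 / 3) powr (1/\<alpha>) * real n powr (- (1/\<alpha>)) \<le> left_preimage n"
proof -
  have eq: "left_preimage n = (left_preimage n powr (-\<alpha>)) powr (- (1/\<alpha>))"
    using alpha_pos left_preimage_pos[of n] by (simp add: powr_powr)
  have bounds: "real n * (\<alpha> / 2) \<le> left_preimage n powr (-\<alpha>)" "left_preimage n powr (-\<alpha>) \<le> 3 * real n"
    using left_preimage_powr_bounds[of n] assms by auto
  have "(left_preimage n powr (-\<alpha>)) powr (- (1/\<alpha>)) \<le> (real n * (\<alpha> / 2)) powr (- (1/\<alpha>))"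
    using bounds alpha_pos assms by (intro powr_mono2') auto
  also have "\<dots> = (2 / \<alpha>) powr (1/\<alpha>) * real n powr (- (1/\<alpha>))"
    using alpha_pos assms by (simp add: powr_mult powr_divide powr_minus field_simps)
  finally show "left_preimage n \<le> (2 / \<alpha>) powr (1/\<alpha>) * real n powr (- (1/\<alpha>))" using eq by simp
  have "(1 / 3) powr (1/\<alpha>) * real n powr (- (1/\<alpha>)) = (3 * real n) powr (- (1/\<alpha>))"
    using alpha_pos assms by (simp add: powr_mult powr_divide powr_minus field_simps)
  also have "\<dots> \<le> (left_preimage n powr (-\<alpha>)) powr (- (1/\<alpha>))"
    using bounds alpha_pos left_preimage_pos[of n] by (intro powr_mono2') auto
  finally show "(1 / 3) powr (1/\<alpha>) * real n powr (- (1/\<alpha>)) \<le> left_preimage n" using eq by simp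
qed

lemma left_preimage_tendsto_0: "left_preimage \<longlonglongrightarrow> 0"
proof (rule tendsto_sandwich[of "\<lambda>n. 0"])
  show "(\<lambda>n. (2 / \<alpha>) powr (1/\<alpha>) * real n powr (- (1/\<alpha>))) \<longlonglongrightarrow> 0"
    using alpha_pos by (intro tendsto_mult_right_zero tendsto_neg_powr filterlim_real_sequentially) auto
  show "\<forall>\<^sub>F n in sequentially. left_preimage n \<le> (2 / \<alpha>) powr (1/\<alpha>) * real n powr (- (1/\<alpha>))"
    using eventually_ge_at_top[of 1] by eventually_elim (rule left_preimage_upper)
  show "\<forall>\<^sub>F n in sequentially. 0 \<le> left_preimage n"
    by (rule always_eventually) (simp add: less_imp_le[OF left_preimage_pos])
qed simp

lemma g_measurable [measurable]: "g \<in> borel_measurable borel"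
  unfolding lsv_def by measurable

lemma g_funpow_measurable [measurable]: "g ^^ n \<in> borel_measurable borel"
  by (induction n) (auto simp: o_def id_def)

lemma g_funpow_le_left_preimage: "0 < x \<Longrightarrow> x \<le> left_preimage (j + k) \<Longrightarrow> (g ^^ k) x \<le> left_preimage j"
proof (induction k arbitrary: x)
  case (Suc k)
  have half: "left_preimage (Suc (j + k)) \<le> 1/2"
    using left_preimage_antimono[of 1 "Suc (j + k)"] by (simp add: left_preimage_Suc)
  have "g x = left_branch x" using Suc.prems half by (intro lsv_left) auto
  also have "\<dots> \<le> left_branch (left_preimage (Suc (j + k)))"
    using Suc.prems left_preimage_pos[of "Suc (j + k)"] by (subst left_branch_le_iff) auto
  also have "\<dots> = left_preimage (j + k)"
    using left_branch_inverse[of "left_preimage (j + k)"] left_preimage_pos[of "j + k"] by (simp add: left_preimage_Suc)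
  finally have "g x \<le> left_preimage (j + k)" .
  moreover have "0 < g x" using Suc.prems left_preimage_le_1[of "j + Suc k"] by (intro g_pos) auto
  ultimately show ?case using Suc.IH[of "g x"] by (simp add: funpow_swap1)
qed simp

section \<open>Images and cylinders of the inverse branches\<close>
abbreviation Y :: "real set" where "Y \<equiv> {1/2<..1}"

lemma word_inverse_image_vimage:
  assumes "B \<subseteq> {0<..1}"
  shows "word_inverse w ` B = {word_inverse w 0<..word_inverse w 1} \<inter> (g ^^ length w) -` B"
proof -
  have "{word_inverse w 0<..word_inverse w 1} = word_inverse w ` {0<..1}"
    using word_inverse_image[of 0 1 w] by simp
  then show ?thesis
    using assms itinerary_word_inverse(1) by (auto simp: image_iff)
qed

lemma word_inverse_image_borel:
  assumes "B \<in> sets borel" "B \<subseteq> {0<..1}"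
  shows "word_inverse w ` B \<in> sets borel"
  using word_inverse_image_vimage[OF assms(2)] assms(1)
    measurable_sets[OF g_funpow_measurable, of B "length w"] by simp

lemma fmeasurable_unit: "B \<in> sets borel \<Longrightarrow> B \<subseteq> {0..1} \<Longrightarrow> B \<in> fmeasurable (lborel :: real measure)"
  by (rule fmeasurableI2[of "{0..1}"]) (auto simp: fmeasurable_def)

lemma word_inverse_image_fmeasurable:
  assumes "B \<in> sets borel" "B \<subseteq> {0<..1}"
  shows "word_inverse w ` B \<in> fmeasurable lborel"
  using assms word_inverse_image_borel word_inverse_nonneg word_inverse_le_1
  by (intro fmeasurable_unit) (auto simp: subset_eq)

lemma word_inverse_image_measure:
  assumes "B \<in> sets borel" "B \<subseteq> Y"
  shows "word_weight w 1 * measure lborel B \<le> measure lborel (word_inverse w ` B)"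
    and "measure lborel (word_inverse w ` B) \<le> 4 * word_weight w 1 * measure lborel B"
proof -
  let ?I = "word_inverse w ` B"
  have B01: "B \<subseteq> {0<..1}" using assms by auto
  have Blm: "B \<in> lmeasurable"
    using fmeasurable_unit[of B] assms order.trans[OF B01 greaterThanAtMost_subseteq_atLeastAtMost_iff[THEN iffD2]]
    by (auto simp: fmeasurable_def)
  have Ilm: "?I \<in> lmeasurable"
    using word_inverse_image_fmeasurable[OF assms(1) B01] by (auto simp: fmeasurable_def)
  have Ib: "?I \<in> sets borel" using word_inverse_image_borel[OF assms(1) B01] .
  have "(\<lambda>x. 1::real) absolutely_integrable_on ?I \<and> integral ?I (\<lambda>x. 1) = measure lebesgue ?I"
    using Ilm by (simp add: lmeasure_integral absolutely_integrable_on_const)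
  then have *: "(\<lambda>x. \<bar>word_weight w x\<bar> * 1) absolutely_integrable_on B \<and>
      integral B (\<lambda>x. \<bar>word_weight w x\<bar> * 1) = measure lebesgue ?I"
  proof (subst has_absolute_integral_change_of_variables_1'[where g="word_inverse w"])
    show "B \<in> sets lebesgue" using Blm by (simp add: fmeasurable_def)
    show "(word_inverse w has_real_derivative word_weight w x) (at x within B)" if "x \<in> B" for x
      using that B01 by (intro has_field_derivative_at_within[OF word_inverse_deriv]) auto
    show "inj_on (word_inverse w) B"
    proof (rule linorder_inj_onI)
      fix x y assume "x < y" "x \<in> B" "y \<in> B"
      then show "word_inverse w x \<noteq> word_inverse w y"
        using word_inverse_less_iff[of x y w] B01 by fastforce
    qed auto
  qed
  then have int: "(\<lambda>x. \<bar>word_weight w x\<bar> * 1) integrable_on B"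
    by (simp add: set_lebesgue_integral_eq_integral(1))
  have c: "(\<lambda>x. c) integrable_on B" "integral B (\<lambda>x. c) = c * measure lborel B" for c :: real
  proof -
    show "(\<lambda>x. c) integrable_on B" using Blm by (simp add: integrable_on_const)
    have "integral B (\<lambda>x. c * 1) = c * integral B (\<lambda>x. 1)" by (rule integral_mult_right)
    then show "integral B (\<lambda>x. c) = c * measure lborel B"
      using Blm assms by (simp add: lmeasure_integral[symmetric])
  qed
  have bound: "word_weight w 1 \<le> \<bar>word_weight w x\<bar> * 1 \<and> \<bar>word_weight w x\<bar> * 1 \<le> 4 * word_weight w 1"
    if "x \<in> B" for x
    using word_weight_distortion[of x w] word_weight_pos[of w x] that assms(2)
    by (auto simp: subset_eq)
  have "integral B (\<lambda>x. word_weight w 1) \<le> integral B (\<lambda>x. \<bar>word_weight w x\<bar> * 1)"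
    using int c bound by (intro integral_le) auto
  then show "word_weight w 1 * measure lborel B \<le> measure lborel ?I"
    using c(2) * Ib by simp
  have "integral B (\<lambda>x. \<bar>word_weight w x\<bar> * 1) \<le> integral B (\<lambda>x. 4 * word_weight w 1)"
    using int c bound by (intro integral_le) auto
  then show "measure lborel ?I \<le> 4 * word_weight w 1 * measure lborel B"
    using c(2)[of "4 * word_weight w 1"] * Ib by (simp only: measure_completion sets_lborel)
qed

text \<open>All branches are full up to the point 0: every cylinder of rank n is mapped onto (0, 1] by the n-th iterate.\<close>
lemma word_images_partition:
  assumes "B \<subseteq> {0<..1}"
  shows "(\<Union>w\<in>{w. length w = n}. word_inverse w ` B) = {0<..1} \<inter> (g ^^ n) -` B"
    and "disjoint_family_on (\<lambda>w. word_inverse w ` B) {w. length w = n}"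
proof -
  show "(\<Union>w\<in>{w. length w = n}. word_inverse w ` B) = {0<..1} \<inter> (g ^^ n) -` B"
  proof (intro equalityI subsetI)
    fix x assume "x \<in> {0<..1} \<inter> (g ^^ n) -` B"
    then have "x = word_inverse (itinerary n x) ((g ^^ n) x)" "(g ^^ n) x \<in> B"
      using word_inverse_itinerary[of x n] by auto
    then show "x \<in> (\<Union>w\<in>{w. length w = n}. word_inverse w ` B)"
      by (intro UN_I[of "itinerary n x"] image_eqI[of _ _ "(g ^^ n) x"]) auto
  next
    fix x assume "x \<in> (\<Union>w\<in>{w. length w = n}. word_inverse w ` B)"
    then obtain w y where w: "length w = n" "y \<in> B" "x = word_inverse w y" by auto
    then have "0 < y" "y \<le> 1" using assms by auto
    then show "x \<in> {0<..1} \<inter> (g ^^ n) -` B"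
      using w word_inverse_pos[of y w] word_inverse_le_1[of y w] itinerary_word_inverse(1)[of y w]
      by simp
  qed
  show "disjoint_family_on (\<lambda>w. word_inverse w ` B) {w. length w = n}"
  proof (unfold disjoint_family_on_def, intro ballI impI equals0I)
    fix v w x assume v: "v \<in> {w. length w = n}" "w \<in> {w. length w = n}" "v \<noteq> w"
      "x \<in> word_inverse v ` B \<inter> word_inverse w ` B"
    then obtain y z where "y \<in> B" "z \<in> B" "x = word_inverse v y" "x = word_inverse w z" by auto
    moreover from this have "0 < y" "y \<le> 1" "0 < z" "z \<le> 1" using assms by auto
    ultimately show False
      using v itinerary_word_inverse(2)[of y v] itinerary_word_inverse(2)[of z w] by simp
  qed
qed

definition cylinder_length :: "bool list \<Rightarrow> real" where
  "cylinder_length w = word_inverse w 1 - word_inverse w 0"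

lemma cylinder_length_pos: "0 < cylinder_length w"
  using word_inverse_less_iff[of 0 1 w] by (simp add: cylinder_length_def)

lemma cylinder_length_True: "cylinder_length (w @ [True]) = word_inverse w 1 - word_inverse w (1/2)"
  by (simp add: cylinder_length_def word_inverse_append branch_inverse_def)

lemma cylinder_length_split: "cylinder_length (w @ [False]) + cylinder_length (w @ [True]) = cylinder_length w"
  by (simp add: cylinder_length_def word_inverse_append branch_inverse_def)

lemma finite_words: "finite {v :: bool list. length v = n}"
  using finite_lists_length_eq[of "UNIV :: bool set" n] by simp

lemma words_Suc: "{v :: bool list. length v = Suc n} =
  (#) False ` {v. length v = n} \<union> (#) True ` {v. length v = n}"
  by (force simp: length_Suc_conv)

lemma sum_cylinder_length: "(\<Sum>v | length v = n. cylinder_length (w @ v)) = cylinder_length w"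
proof (induction n arbitrary: w)
  case (Suc n)
  have "(\<Sum>v | length v = Suc n. cylinder_length (w @ v)) =
      (\<Sum>v | length v = n. cylinder_length ((w @ [False]) @ v)) +
      (\<Sum>v | length v = n. cylinder_length ((w @ [True]) @ v))"
    unfolding words_Suc using finite_words[of n]
    by (subst sum.union_disjoint) (auto simp: sum.reindex)
  then show ?case unfolding Suc using cylinder_length_split by simp
qed simp

lemma cylinder_length_weight:
  "word_weight w 1 \<le> 2 * cylinder_length (w @ [True])" "cylinder_length (w @ [True]) \<le> 2 * word_weight w 1"
  using word_inverse_increment[of "1/2" 1 w] by (simp_all add: cylinder_length_True)

lemma measure_word_inverse_Y: "measure lborel (word_inverse w ` Y) = cylinder_length (w @ [True])"
proof -
  have "word_inverse w (1/2) \<le> word_inverse w 1" using word_inverse_le_iff[of "1/2" 1 w] by simp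
  then show ?thesis using word_inverse_image[of "1/2" 1 w] by (simp add: cylinder_length_True)
qed

text \<open>The sum telescopes, since the points of (0, 1] with exactly k left steps before the entry
into Y form the interval between two consecutive left preimages.\<close>
lemma sum_returns:
  "(\<Sum>k\<le>m. cylinder_length (w @ replicate k False @ [True])) \<le> cylinder_length w"
proof -
  have telescope: "(\<Sum>k\<le>m. f k - f (Suc k)) = f 0 - f (Suc m)" for f :: "nat \<Rightarrow> real"
    by (induction m) simp_all
  have "cylinder_length (w @ replicate k False @ [True]) =
      word_inverse w (left_preimage k) - word_inverse w (left_preimage (Suc k))" for k
    using cylinder_length_True[of "w @ replicate k False"] left_word_inverse[of k 0] left_word_inverse[of k 1]
    by (simp add: word_inverse_append left_preimage_Suc)
  then have "(\<Sum>k\<le>m. cylinder_length (w @ replicate k False @ [True])) =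
      word_inverse w (left_preimage 0) - word_inverse w (left_preimage (Suc m))"
    using telescope[of "\<lambda>k. word_inverse w (left_preimage k)"] by simp
  also have "\<dots> \<le> cylinder_length w"
    using word_inverse_le_iff[of 0 "left_preimage (Suc m)" w] left_preimage_pos[of "Suc m"]
    by (simp add: cylinder_length_def)
  finally show ?thesis .
qed

section \<open>Orbits that avoid a cylinder\<close>
definition avoids :: "real set \<Rightarrow> nat \<Rightarrow> real set" where
  "avoids K n = {x. \<forall>i\<in>{1..n}. (g ^^ i) x \<notin> K}"

lemma avoids_borel [measurable]: "K \<in> sets borel \<Longrightarrow> avoids K n \<in> sets borel"
proof -
  assume [measurable]: "K \<in> sets borel"
  have "avoids K n = space borel - (\<Union>i\<in>{1..n}. (g ^^ i) -` K \<inter> space borel)"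
    by (auto simp: avoids_def)
  moreover have "(\<Union>i\<in>{1..n}. (g ^^ i) -` K \<inter> space borel) \<in> sets borel"
    by (intro sets.finite_UN measurable_sets[OF g_funpow_measurable]) auto
  ultimately show ?thesis by (simp only: sets.compl_sets)
qed

lemma first_entry:
  assumes "0 < y" "y \<le> 1" "left_preimage (Suc m) < y"
  obtains k where "k \<le> m" "(g ^^ k) y \<in> Y" "y = word_inverse (replicate k False) ((g ^^ k) y)"
proof -
  define k where "k = (LEAST k. left_preimage (Suc k) < y)"
  have k: "left_preimage (Suc k) < y" "k \<le> m"
    using assms(3) unfolding k_def by (auto intro: LeastI Least_le)
  have "y \<le> left_preimage k"
  proof (cases k)
    case (Suc j)
    then show ?thesis using not_less_Least[of j "\<lambda>k. left_preimage (Suc k) < y"] k_def by fastforce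
  qed (use assms in simp)
  then have "y \<in> word_inverse (replicate k False) ` Y"
    using word_inverse_image[of "left_preimage 1" 1 "replicate k False"] k(1)
      left_word_inverse[of k 0] left_word_inverse[of k 1]
    by (simp add: left_preimage_Suc)
  then obtain z where z: "z \<in> Y" "y = word_inverse (replicate k False) z" by auto
  then have "(g ^^ k) y = z" using itinerary_word_inverse(1)[of z "replicate k False"] by simp
  with k z that show thesis by simp
qed

text \<open>One block of an orbit that starts in Y: the right branch, then a word v of the length of ws, then k left
steps up to the next visit to Y. The word v cannot be ws, because the orbit would be in K at time 1.
The first set of the union collects the points with more than m left steps.\<close>
lemma avoid_decomposition:
  fixes w ws :: "bool list"
  defines "K \<equiv> word_inverse ws ` {0<..1}"
  assumes n: "1 \<le> n"
  shows "word_inverse w ` (Y \<inter> avoids K n) \<subseteq>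
    (\<Union>v\<in>{v. length v = length ws} - {ws}.
      word_inverse (w @ True # v) ` {0<..left_preimage (Suc m)} \<union>
      (\<Union>k\<le>m. word_inverse ((w @ True # v) @ replicate k False) `
        (Y \<inter> avoids K (n - Suc (length ws) - k))))"
proof (intro subsetI, elim imageE)
  fix x z assume z: "x = word_inverse w z" "z \<in> Y \<inter> avoids K n"
  define y where "y = (g ^^ Suc (length ws)) z"
  define v where "v = itinerary (length ws) (g z)"
  have zpos: "0 < z" "z \<le> 1" using z by auto
  have y: "0 < y" "y \<le> 1"
    unfolding y_def using zpos g_funpow_pos g_funpow_unit[of z] by (auto simp del: funpow.simps)
  have zy: "z = word_inverse (True # v) y"
    using word_inverse_itinerary[of z "Suc (length ws)"] z(2) zpos by (simp add: v_def y_def)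
  have "v \<noteq> ws"
  proof
    assume "v = ws"
    then have "g z = word_inverse ws y"
      using word_inverse_itinerary[of "g z" "length ws"] zpos g_unit[of z]
      by (simp add: v_def y_def funpow_swap1)
    then have "(g ^^ 1) z \<in> K" using y by (simp add: K_def)
    moreover have "\<forall>i\<in>{1..n}. (g ^^ i) z \<notin> K" using z(2) by (simp add: avoids_def)
    ultimately show False using n bspec[of "{1..n}" "\<lambda>i. (g ^^ i) z \<notin> K" 1] by simp
  qed
  then have v: "v \<in> {v. length v = length ws} - {ws}" by (simp add: v_def)
  have xy: "x = word_inverse (w @ True # v) y" using z zy by (simp add: word_inverse_append)
  show "x \<in> (\<Union>v\<in>{v. length v = length ws} - {ws}.
      word_inverse (w @ True # v) ` {0<..left_preimage (Suc m)} \<union>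
      (\<Union>k\<le>m. word_inverse ((w @ True # v) @ replicate k False) `
        (Y \<inter> avoids K (n - Suc (length ws) - k))))"
  proof (cases "y \<le> left_preimage (Suc m)")
    case True
    then have "x \<in> word_inverse (w @ True # v) ` {0<..left_preimage (Suc m)}"
      unfolding xy using y by (intro imageI) simp
    then show ?thesis by (intro UN_I[OF v] UnI1)
  next
    case False
    then obtain k where k: "k \<le> m" "(g ^^ k) y \<in> Y" "y = word_inverse (replicate k False) ((g ^^ k) y)"
      using first_entry[of y m] y by auto
    let ?u = "(g ^^ k) y"
    have "(g ^^ i) ?u \<notin> K" if "i \<in> {1..n - Suc (length ws) - k}" for i
    proof -
      have "(g ^^ i) ?u = (g ^^ (i + (k + Suc (length ws)))) z"
        unfolding y_def funpow_add by simp
      moreover have "i + (k + Suc (length ws)) \<in> {1..n}" using that by auto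
      ultimately show ?thesis using z(2) unfolding avoids_def by (auto simp del: funpow.simps)
    qed
    then have "?u \<in> Y \<inter> avoids K (n - Suc (length ws) - k)" using k by (auto simp: avoids_def)
    moreover have "x = word_inverse ((w @ True # v) @ replicate k False) ?u"
      using xy k(3) by (metis word_inverse_append)
    ultimately have "x \<in> word_inverse ((w @ True # v) @ replicate k False) `
        (Y \<inter> avoids K (n - Suc (length ws) - k))" by (intro image_eqI)
    then show ?thesis using k(1) by (intro UN_I[OF v] UnI2 UN_I[of k]) simp_all
  qed
qed

text \<open>Let T n w be the measure of the points of the cylinder of w whose image after that word lies in Y and
avoids K for n further steps, and let N w be its value without the condition on K. The decomposition
gives T n w \<le> c * left_preimage (m + 1) * N w + (\<Sum>T (n - s - k) w'), where the sum runs over the extensions w' of w by a block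
with k \<le> m, and bounded distortion gives (\<Sum>N w') \<le> (1 - p) * N w with p > 0 that does not depend on w.
Taking m proportional to n, with a small enough factor \<eta>, the loss from n - s - m instead of n in the
induction hypothesis is absorbed by the factor 1 - p.\<close>
lemma escape_tail:
  fixes ws :: "bool list"
  defines "K \<equiv> word_inverse ws ` {0<..1}"
  obtains A where "0 < A"
    "\<And>n w. 1 \<le> n \<Longrightarrow> measure lborel (word_inverse w ` (Y \<inter> avoids K n))
       \<le> A * real n powr (- (1/\<alpha>)) * cylinder_length (w @ [True])"
proof -
  define \<beta> where "\<beta> = 1/\<alpha>"
  have \<beta>: "0 < \<beta>" "\<alpha> * \<beta> = 1" using alpha_pos by (auto simp: \<beta>_def)
  define T where "T = (\<lambda>n w. measure lborel (word_inverse w ` (Y \<inter> avoids K n)))"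
  define N where "N = (\<lambda>w. cylinder_length (w @ [True]))"
  have N_pos: "0 < N w" for w by (simp add: N_def cylinder_length_pos)
  define s where "s = Suc (length ws)"
  define V where "V = {v. length v = length ws} - {ws}"
  have finV: "finite V" unfolding V_def using finite_words by simp
  have K_borel [measurable]: "K \<in> sets borel"
    unfolding K_def by (intro word_inverse_image_borel) auto
  have fm: "word_inverse w ` (Y \<inter> avoids K n) \<in> fmeasurable lborel" for w n
    by (intro word_inverse_image_fmeasurable) auto
  have T_le_N: "T n w \<le> N w" for n w
    unfolding T_def N_def measure_word_inverse_Y[symmetric]
    by (intro measure_mono_fmeasurable fmeasurableD[OF fm] word_inverse_image_fmeasurable) auto

  define L where "L = cylinder_length (True # ws)"
  have L: "0 < L" "L \<le> 1/2"
  proof -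
    show "0 < L" by (simp add: L_def cylinder_length_pos)
    show "L \<le> 1/2"
      using word_inverse_lipschitz[of 1 0 ws] by (simp add: L_def cylinder_length_def branch_inverse_def diff_divide_distrib[symmetric])
  qed
  \<comment> \<open>distortion at most 4 on an interval of length 1/2 costs the factor 1/2\<close>
  define p where "p = L / 2"
  have p: "0 < p" "p \<le> 1/4" using L by (auto simp: p_def)

  have step: "T n w \<le> real (card V) * (8 * left_preimage (Suc m)) * N w
      + (\<Sum>v\<in>V. \<Sum>k\<le>m. T (n - s - k) ((w @ True # v) @ replicate k False))"
    if "1 \<le> n" for n m w
  proof -
    let ?A = "\<lambda>v. word_inverse (w @ True # v) ` {0<..left_preimage (Suc m)}"
    let ?B = "\<lambda>v k. word_inverse ((w @ True # v) @ replicate k False) ` (Y \<inter> avoids K (n - s - k))"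
    have A: "?A v \<in> fmeasurable lborel" for v
      using left_preimage_le_1[of "Suc m"] by (intro word_inverse_image_fmeasurable) auto
    have AB: "?A v \<union> (\<Union>k\<le>m. ?B v k) \<in> fmeasurable lborel" for v
      using A fm by (intro fmeasurable.Un fmeasurable.finite_UN) auto
    have "T n w \<le> measure lborel (\<Union>v\<in>V. ?A v \<union> (\<Union>k\<le>m. ?B v k))"
      unfolding T_def
    proof (rule measure_mono_fmeasurable)
      show "word_inverse w ` (Y \<inter> avoids K n) \<subseteq> (\<Union>v\<in>V. ?A v \<union> (\<Union>k\<le>m. ?B v k))"
        using avoid_decomposition[OF that, of w ws m] unfolding K_def V_def s_def by simp
      show "(\<Union>v\<in>V. ?A v \<union> (\<Union>k\<le>m. ?B v k)) \<in> fmeasurable lborel"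
        using AB finV by (intro fmeasurable.finite_UN) auto
    qed (rule fmeasurableD[OF fm])
    also have "\<dots> \<le> (\<Sum>v\<in>V. measure lborel (?A v \<union> (\<Union>k\<le>m. ?B v k)))"
      using finV by (intro measure_UNION_le fmeasurableD[OF AB])
    also have "\<dots> \<le> (\<Sum>v\<in>V. 8 * left_preimage (Suc m) * N w
        + (\<Sum>k\<le>m. T (n - s - k) ((w @ True # v) @ replicate k False)))"
    proof (rule sum_mono)
      fix v
      have "measure lborel (?A v) = word_inverse w (word_inverse (True # v) (left_preimage (Suc m)))
          - word_inverse w (word_inverse (True # v) 0)"
        using word_inverse_image[of 0 "left_preimage (Suc m)" "w @ True # v"] left_preimage_le_1[of "Suc m"]
          left_preimage_pos[of "Suc m"] word_inverse_le_iff[of 0 "left_preimage (Suc m)" "w @ True # v"]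
        by (simp add: word_inverse_append)
      also have "\<dots> \<le> 4 * word_weight w 1 *
          (word_inverse (True # v) (left_preimage (Suc m)) - word_inverse (True # v) 0)"
      proof (rule word_inverse_increment)
        show "1/2 \<le> word_inverse (True # v) 0"
          using word_inverse_nonneg[of 0 v] by (simp add: branch_inverse_def)
        show "word_inverse (True # v) 0 \<le> word_inverse (True # v) (left_preimage (Suc m))"
          using word_inverse_le_iff[of 0 "left_preimage (Suc m)" "True # v"] left_preimage_pos[of "Suc m"] by simp
        show "word_inverse (True # v) (left_preimage (Suc m)) \<le> 1"
          using left_preimage_le_1[of "Suc m"] left_preimage_pos[of "Suc m"] by (intro word_inverse_le_1) auto
      qed
      also have "\<dots> \<le> 4 * (2 * N w) * left_preimage (Suc m)"
      proof (intro mult_mono)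
        show "word_weight w 1 \<le> 2 * N w" unfolding N_def by (rule cylinder_length_weight)
        show "word_inverse (True # v) (left_preimage (Suc m)) - word_inverse (True # v) 0 \<le> left_preimage (Suc m)"
          using word_inverse_lipschitz[of "left_preimage (Suc m)" 0 "True # v"]
            left_preimage_le_1[of "Suc m"] left_preimage_pos[of "Suc m"] by simp
        show "0 \<le> word_inverse (True # v) (left_preimage (Suc m)) - word_inverse (True # v) 0"
          using word_inverse_le_iff[of 0 "left_preimage (Suc m)" "True # v"] left_preimage_pos[of "Suc m"] by simp
      qed (use less_imp_le[OF N_pos[of w]] less_imp_le[OF word_weight_pos[of w 1]] in auto)
      finally have "measure lborel (?A v) \<le> 8 * left_preimage (Suc m) * N w" by (simp add: mult_ac)
      moreover have "measure lborel (\<Union>k\<le>m. ?B v k) \<le> (\<Sum>k\<le>m. measure lborel (?B v k))"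
        by (intro measure_UNION_le fmeasurableD[OF fm]) simp
      moreover have "measure lborel (?A v \<union> (\<Union>k\<le>m. ?B v k)) \<le>
          measure lborel (?A v) + measure lborel (\<Union>k\<le>m. ?B v k)"
        by (intro measure_Un_le fmeasurableD[OF A] sets.finite_UN fmeasurableD[OF fm]) simp
      ultimately show "measure lborel (?A v \<union> (\<Union>k\<le>m. ?B v k)) \<le> 8 * left_preimage (Suc m) * N w
        + (\<Sum>k\<le>m. T (n - s - k) ((w @ True # v) @ replicate k False))"
        unfolding T_def by linarith
    qed
    also have "\<dots> = real (card V) * (8 * left_preimage (Suc m)) * N w
      + (\<Sum>v\<in>V. \<Sum>k\<le>m. T (n - s - k) ((w @ True # v) @ replicate k False))"
      by (simp add: sum.distrib)
    finally show ?thesis .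
  qed

  have returns: "(\<Sum>v\<in>V. \<Sum>k\<le>m. N ((w @ True # v) @ replicate k False)) \<le> (1 - p) * N w" for m w
  proof -
    have "(\<Sum>v\<in>V. \<Sum>k\<le>m. N ((w @ True # v) @ replicate k False)) \<le> (\<Sum>v\<in>V. cylinder_length (w @ True # v))"
      using sum_returns[of "w @ True # _" m] by (intro sum_mono) (simp add: N_def)
    also have "\<dots> = N w - cylinder_length (w @ True # ws)"
      using sum_cylinder_length[of "w @ [True]" "length ws"] finite_words[of "length ws"]
      unfolding V_def N_def by (simp add: sum_diff1)
    finally have "(\<Sum>v\<in>V. \<Sum>k\<le>m. N ((w @ True # v) @ replicate k False))
        \<le> N w - cylinder_length (w @ True # ws)" .
    moreover have "p * N w \<le> cylinder_length (w @ True # ws)"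
    proof -
      have "p * N w \<le> p * (2 * word_weight w 1)"
        using p cylinder_length_weight(2)[of w] unfolding N_def by (intro mult_left_mono) auto
      also have "\<dots> = word_weight w 1 * (word_inverse (True # ws) 1 - word_inverse (True # ws) 0)"
        by (simp add: p_def L_def cylinder_length_def)
      also have "\<dots> \<le> word_inverse w (word_inverse (True # ws) 1) - word_inverse w (word_inverse (True # ws) 0)"
      proof (rule word_inverse_increment)
        show "1/2 \<le> word_inverse (True # ws) 0"
          using word_inverse_nonneg[of 0 ws] by (simp add: branch_inverse_def)
        show "word_inverse (True # ws) 0 \<le> word_inverse (True # ws) 1"
          using word_inverse_le_iff[of 0 1 "True # ws"] by simp
        show "word_inverse (True # ws) 1 \<le> 1" by (intro word_inverse_le_1) auto
      qed
      finally show ?thesis by (simp add: cylinder_length_def word_inverse_append)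
    qed
    ultimately show ?thesis by (simp add: algebra_simps)
  qed

  \<comment> \<open>n - s - m \<ge> (1 - 2 \<eta>) n and (1 - 2 \<eta>) powr (-\<beta>) = 1 / r, which turns the factor 1 - p into 1 - p / 2\<close>
  define r where "r = (1 - p) / (1 - p / 2)"
  have r: "0 < r" "r < 1" using p by (auto simp: r_def field_simps)
  define \<eta> where "\<eta> = (1 - r powr \<alpha>) / 2"
  have r\<alpha>: "0 < r powr \<alpha>" "r powr \<alpha> < 1"
    using r alpha_pos powr_less_mono2[of \<alpha> r 1] by auto
  have "0 < (1 - q) / 2 \<and> (1 - q) / 2 < 1" if "0 < q" "q < 1" for q :: real
    using that by simp
  from this[OF r\<alpha>] have \<eta>: "0 < \<eta>" "\<eta> < 1" unfolding \<eta>_def by blast+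
  \<comment> \<open>from n0 on, the block length s is at most \<eta> n\<close>
  define n0 where "n0 = Suc (nat \<lceil>real s / \<eta>\<rceil>)"
  define c where "c = real (card V) * 8 * ((2 / \<alpha>) powr \<beta> * \<eta> powr (-\<beta>))"
  have c: "0 \<le> c" by (simp add: c_def)
  \<comment> \<open>the first summand covers n < n0, the second leaves room for the long blocks in the gap p / 2\<close>
  define A where "A = real n0 powr \<beta> + 2 * c / p"
  have A: "real n0 powr \<beta> \<le> A" "c \<le> A * (p / 2)" "0 < A"
  proof -
    show "real n0 powr \<beta> \<le> A" "0 < A" using c p by (auto simp: A_def n0_def add_pos_nonneg)
    show "c \<le> A * (p / 2)" using c p by (simp add: A_def field_simps)
  qed
  have main: "1 \<le> n \<Longrightarrow> T n w \<le> A * real n powr (-\<beta>) * N w" for n w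
  proof (induction n arbitrary: w rule: less_induct)
    case (less n)
    show ?case
    proof (cases "n < n0")
      case True
      have "real n powr \<beta> \<le> real n0 powr \<beta>" using True \<beta> by (intro powr_mono2) auto
      also have "\<dots> \<le> A" by (rule A)
      finally have "1 \<le> A * real n powr (-\<beta>)"
        using less.prems by (simp add: powr_minus field_simps)
      then have "1 * N w \<le> A * real n powr (-\<beta>) * N w"
        using N_pos[of w] by (intro mult_right_mono) auto
      then show ?thesis using T_le_N[of n w] by simp
    next
      case False
      define m where "m = nat \<lfloor>\<eta> * real n\<rfloor>"
      have m: "real m \<le> \<eta> * real n" "\<eta> * real n \<le> real (Suc m)"
        using \<eta> by (auto simp: m_def) linarith
      have "real s / \<eta> \<le> real n" using False unfolding n0_def by linarith
      then have s: "real s \<le> \<eta> * real n" using \<eta> by (simp add: field_simps)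
      have "real s + real m \<le> (1 - r powr \<alpha>) * real n" using s m by (simp add: \<eta>_def)
      then have large: "r powr \<alpha> * real n \<le> real n - real s - real m" by (simp add: algebra_simps)
      have "0 < r powr \<alpha> * real n" using less.prems r\<alpha> by simp
      with large have sm: "s + m < n" by linarith
      have "T (n - s - k) u \<le> A * ((1 / r) * real n powr (-\<beta>)) * N u" if "k \<le> m" for k u
      proof -
        have "T (n - s - k) u \<le> A * real (n - s - k) powr (-\<beta>) * N u"
          using sm that by (intro less.IH) (auto simp: s_def)
        also have "real (n - s - k) powr (-\<beta>) \<le> (r powr \<alpha> * real n) powr (-\<beta>)"
          using large sm that \<beta> r\<alpha> less.prems by (intro powr_mono2') (auto simp: of_nat_diff)
        also have "(r powr \<alpha> * real n) powr (-\<beta>) = (1 / r) * real n powr (-\<beta>)"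
          using r \<beta> by (simp add: powr_mult powr_powr powr_minus field_simps)
        finally show ?thesis using A(3) N_pos[of u] by (simp add: mult_left_mono mult_right_mono)
      qed
      then have "(\<Sum>v\<in>V. \<Sum>k\<le>m. T (n - s - k) ((w @ True # v) @ replicate k False)) \<le>
         (\<Sum>v\<in>V. \<Sum>k\<le>m. A * ((1 / r) * real n powr (-\<beta>)) * N ((w @ True # v) @ replicate k False))"
        by (intro sum_mono) auto
      also have "\<dots> = A * ((1 / r) * real n powr (-\<beta>)) *
          (\<Sum>v\<in>V. \<Sum>k\<le>m. N ((w @ True # v) @ replicate k False))"
        by (simp add: sum_distrib_left)
      also have "\<dots> \<le> A * ((1 / r) * real n powr (-\<beta>)) * ((1 - p) * N w)"
        using A(3) r by (intro mult_left_mono returns) auto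
      also have "\<dots> = A * (1 - p / 2) * (real n powr (-\<beta>) * N w)"
        using p by (simp add: r_def field_simps)
      finally have sum: "(\<Sum>v\<in>V. \<Sum>k\<le>m. T (n - s - k) ((w @ True # v) @ replicate k False)) \<le>
          A * (1 - p / 2) * (real n powr (-\<beta>) * N w)" .
      have "left_preimage (Suc m) \<le> (2 / \<alpha>) powr \<beta> * real (Suc m) powr (-\<beta>)"
        unfolding \<beta>_def by (rule left_preimage_upper) simp
      also have "\<dots> \<le> (2 / \<alpha>) powr \<beta> * (\<eta> * real n) powr (-\<beta>)"
        using m(2) \<eta> less.prems \<beta> by (intro mult_left_mono powr_mono2') auto
      also have "\<dots> = ((2 / \<alpha>) powr \<beta> * \<eta> powr (-\<beta>)) * real n powr (-\<beta>)"
        using \<eta> by (simp add: powr_mult)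
      finally have "real (card V) * (8 * left_preimage (Suc m)) * N w \<le>
          real (card V) * (8 * (((2 / \<alpha>) powr \<beta> * \<eta> powr (-\<beta>)) * real n powr (-\<beta>))) * N w"
        using N_pos[of w] by (intro mult_right_mono mult_left_mono) auto
      also have "\<dots> = c * (real n powr (-\<beta>) * N w)" by (simp add: c_def mult_ac)
      also have "\<dots> \<le> A * (p / 2) * (real n powr (-\<beta>) * N w)"
        using A(2) N_pos[of w] by (intro mult_right_mono) auto
      finally show ?thesis
        using step[OF less.prems, of w m] sum by (simp add: algebra_simps)
    qed
  qed
  show thesis
    using main A(3) unfolding T_def N_def \<beta>_def by (intro that) auto
qed

end

section \<open>Absolutely continuous invariant measures\<close>
text \<open>This replaces the comparison of the tail of the series of n powr (-\<beta>) with an integral.\<close>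
lemma powr_difference_lower:
  assumes n: "1 \<le> n" and \<beta>: "1 < \<beta>"
  shows "real n powr (-\<beta>) \<le> 2 powr \<beta> / (\<beta> - 1) * (real n powr (1 - \<beta>) - real (Suc n) powr (1 - \<beta>))"
proof -
  have "\<exists>z>real n. z < real (Suc n) \<and>
      real (Suc n) powr (1 - \<beta>) - real n powr (1 - \<beta>) = (real (Suc n) - real n) * ((1 - \<beta>) * z powr (1 - \<beta> - 1))"
    using n by (intro MVT2 has_real_derivative_powr) auto
  then obtain z where z: "real n < z" "z < real (Suc n)"
    "real n powr (1 - \<beta>) - real (Suc n) powr (1 - \<beta>) = (\<beta> - 1) * z powr (-\<beta>)"
    by (auto simp: algebra_simps)
  have "(2 * real n) powr (-\<beta>) \<le> z powr (-\<beta>)"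
    using z n \<beta> by (intro powr_mono2') auto
  then have "2 powr \<beta> * (2 * real n) powr (-\<beta>) \<le> 2 powr \<beta> * z powr (-\<beta>)"
    by (intro mult_left_mono) auto
  moreover have "2 powr \<beta> * (2 * real n) powr (-\<beta>) = real n powr (-\<beta>)"
    by (simp add: powr_mult powr_minus)
  ultimately have "real n powr (-\<beta>) \<le> 2 powr \<beta> * z powr (-\<beta>)" by simp
  then show ?thesis using z(3) \<beta> by simp
qed

text \<open>Truncating D makes it bounded; a bounded measurable function is an almost everywhere limit of
continuous ones, which can be clipped to the same bounds. Both limits hold in mean by dominated
convergence.\<close>
lemma integrable_approx_continuous_nonneg:
  fixes D :: "real \<Rightarrow> real"
  assumes D: "integrable lborel D" "\<And>x. 0 \<le> D x" and e: "0 < e"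
  obtains k where "continuous_on UNIV k" "\<And>x. 0 \<le> k x"
    "(LINT x:{0..1}|lborel. \<bar>D x - k x\<bar>) < e"
proof -
  have [measurable]: "D \<in> borel_measurable borel" using D(1) by auto
  have "(\<lambda>M. LINT x|lborel. D x - min (D x) (real M)) \<longlonglongrightarrow> (LINT x|(lborel::real measure). 0)"
  proof (rule integral_dominated_convergence[where w=D])
    show "AE x in lborel. (\<lambda>M. D x - min (D x) (real M)) \<longlonglongrightarrow> 0"
    proof (rule AE_I2)
      fix x
      obtain M0 where "D x < real M0" using reals_Archimedean2 by blast
      then have "\<forall>\<^sub>F M in sequentially. D x - min (D x) (real M) = 0"
        by (intro eventually_sequentiallyI[of M0]) auto
      then show "(\<lambda>M. D x - min (D x) (real M)) \<longlonglongrightarrow> 0" by (rule tendsto_eventually)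
    qed
  qed (use D in auto)
  then have "(\<lambda>M. LINT x|lborel. D x - min (D x) (real M)) \<longlonglongrightarrow> 0" by simp
  from LIMSEQ_D[OF this, of "e / 2"] e
  obtain M where M: "norm ((LINT x|lborel. D x - min (D x) (real M)) - 0) < e / 2" by auto
  define u where "u = (\<lambda>x. min (D x) (real M))"
  have [measurable]: "u \<in> borel_measurable borel" unfolding u_def by measurable
  have "u measurable_on UNIV"
    by (rule lebesgue_measurable_imp_measurable_on_real) (auto simp: measurable_completion)
  then obtain N G where N: "negligible N" and G: "\<And>n. continuous_on UNIV (G n)"
    and lim: "\<And>x. x \<notin> N \<Longrightarrow> (\<lambda>n. G n x) \<longlonglongrightarrow> u x"
    unfolding measurable_on_def by auto
  define K where "K = (\<lambda>n x. max 0 (min (real M) (G n x :: real)))"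
  have K: "continuous_on UNIV (K n)" "0 \<le> K n x" "K n x \<le> real M" for n x
    unfolding K_def using G by (auto intro!: continuous_intros)
  have [measurable]: "K n \<in> borel_measurable borel" for n
    using K(1) by (rule borel_measurable_continuous_onI)
  have "AE x in lebesgue. x \<notin> N"
    using N by (intro AE_not_in) (simp add: negligible_iff_null_sets)
  then have AE: "AE x in lborel. x \<notin> N" by (simp add: AE_completion_iff)
  have "(\<lambda>n. LINT x:{0..1}|lborel. \<bar>u x - K n x\<bar>) \<longlonglongrightarrow> (LINT x|(lborel::real measure). 0)"
    unfolding set_lebesgue_integral_def
  proof (rule integral_dominated_convergence[where w="\<lambda>x. indicator {0..1} x * real M"])
    show "AE x in lborel. (\<lambda>n. indicat_real {0..1} x *\<^sub>R \<bar>u x - K n x\<bar>) \<longlonglongrightarrow> 0"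
      using AE
    proof eventually_elim
      case (elim x)
      have "(\<lambda>n. K n x) \<longlonglongrightarrow> max 0 (min (real M) (u x))"
        unfolding K_def by (intro tendsto_intros lim elim)
      also have "max 0 (min (real M) (u x)) = u x" using D(2) by (simp add: u_def min_def max_def)
      finally have "(\<lambda>n. indicat_real {0..1} x *\<^sub>R \<bar>u x - K n x\<bar>) \<longlonglongrightarrow> indicat_real {0..1} x *\<^sub>R \<bar>u x - u x\<bar>"
        by (intro tendsto_intros)
      then show ?case by simp
    qed
    show "AE x in lborel. norm (indicat_real {0..1} x *\<^sub>R \<bar>u x - K n x\<bar>) \<le> indicat_real {0..1} x * real M" for n
      using K(2,3)[of n] D(2) by (auto simp: indicator_def u_def abs_le_iff min_le_iff_disj intro!: AE_I2) (smt (verit, best) K(2,3) min_def)+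
  qed auto
  then have "(\<lambda>n. LINT x:{0..1}|lborel. \<bar>u x - K n x\<bar>) \<longlonglongrightarrow> 0" by simp
  from LIMSEQ_D[OF this, of "e / 2"] e
  obtain n where n: "norm ((LINT x:{0..1}|lborel. \<bar>u x - K n x\<bar>) - 0) < e / 2" by auto
  have int1: "integrable lborel (\<lambda>x. D x - u x)"
    unfolding u_def using D by (intro Bochner_Integration.integrable_bound[OF D(1)]) auto
  have int2: "set_integrable lborel {0..1} (\<lambda>x. \<bar>u x - K n x\<bar>)"
    unfolding set_integrable_def
  proof (rule Bochner_Integration.integrable_bound[where f="\<lambda>x. indicat_real {0..1} x * real M"])
    show "AE x in lborel. norm (indicat_real {0..1} x *\<^sub>R \<bar>u x - K n x\<bar>) \<le> norm (indicat_real {0..1} x * real M)"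
      using K(2,3)[of n] D(2) by (auto simp: indicator_def u_def intro!: AE_I2) (smt (verit, best) K(2,3) min_def)+
  qed auto
  have int1': "set_integrable lborel {0..1} (\<lambda>x. D x - u x)"
    unfolding set_integrable_def using int1 by (intro integrable_mult_indicator) auto
  have "(LINT x:{0..1}|lborel. \<bar>D x - K n x\<bar>) \<le> (LINT x:{0..1}|lborel. (D x - u x) + \<bar>u x - K n x\<bar>)"
  proof (rule set_integral_mono)
    show sum: "set_integrable lborel {0..1} (\<lambda>x. (D x - u x) + \<bar>u x - K n x\<bar>)"
      using int1' int2 by (rule set_integral_add)
    have *: "\<bar>D x - K n x\<bar> \<le> (D x - u x) + \<bar>u x - K n x\<bar>" for x
      using D(2)[of x] by (auto simp: u_def)
    show "\<And>x. \<bar>D x - K n x\<bar> \<le> (D x - u x) + \<bar>u x - K n x\<bar>" by (rule *)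
    show "set_integrable lborel {0..1} (\<lambda>x. \<bar>D x - K n x\<bar>)"
      using sum unfolding set_integrable_def
      by (rule Bochner_Integration.integrable_bound)
        (auto simp: indicator_def intro: order.trans[OF * abs_ge_self])
  qed
  also have "\<dots> = (LINT x:{0..1}|lborel. D x - u x) + (LINT x:{0..1}|lborel. \<bar>u x - K n x\<bar>)"
    using int1' int2 by (rule set_integral_add)
  also have "(LINT x:{0..1}|lborel. D x - u x) \<le> (LINT x|lborel. D x - u x)"
    unfolding set_lebesgue_integral_def using int1 int1'
    by (intro integral_mono) (auto simp: set_integrable_def indicator_def u_def)
  finally have "(LINT x:{0..1}|lborel. \<bar>D x - K n x\<bar>) < e"
    using M n unfolding u_def by (auto simp: abs_less_iff)
  with K show thesis by (intro that)
qed

locale intermittent_acip = intermittent_map + prob_space \<nu> for \<nu> :: "real measure" +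
  assumes sets_nu [measurable_cong]: "sets \<nu> = sets borel"
    and absolutely_continuous: "absolutely_continuous lborel \<nu>"
    and nu_unit: "measure \<nu> (- {0..1}) = 0"
    and invariant: "B \<in> sets borel \<Longrightarrow> measure \<nu> (g -` B) = measure \<nu> B"
begin

lemma nu_outside_unit: "measure \<nu> (- {0<..1}) = 0"
proof -
  have "{0::real} \<in> null_sets lborel" by auto
  then have "{0} \<in> null_sets \<nu>"
    using absolutely_continuous unfolding absolutely_continuous_def by blast
  then have "measure \<nu> {0} = 0" by (rule measure_eq_0_null_sets)
  moreover have "- {0<..1} = {0} \<union> - {0..1::real}" by auto
  moreover have "measure \<nu> ({0} \<union> - {0..1}) \<le> measure \<nu> {0} + measure \<nu> (- {0..1})"
    by (intro measure_Un_le) (auto simp: sets_nu)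
  ultimately show ?thesis using nu_unit measure_nonneg[of \<nu> "- {0<..1}"] by (simp del: measure_nonneg)
qed

lemma nu_restrict: "measure \<nu> B = measure \<nu> (B \<inter> {0<..1})" if [measurable]: "B \<in> sets borel"
proof (rule antisym)
  have "measure \<nu> B \<le> measure \<nu> ((B \<inter> {0<..1}) \<union> - {0<..1})"
    by (intro finite_measure_mono) auto
  also have "\<dots> \<le> measure \<nu> (B \<inter> {0<..1}) + measure \<nu> (- {0<..1})"
    by (intro measure_Un_le) auto
  finally show "measure \<nu> B \<le> measure \<nu> (B \<inter> {0<..1})" by (simp add: nu_outside_unit)
qed (intro finite_measure_mono, auto)

lemma invariant_funpow: "B \<in> sets borel \<Longrightarrow> measure \<nu> ((g ^^ n) -` B) = measure \<nu> B"
proof (induction n)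
  case (Suc n)
  have "(g ^^ Suc n) -` B = g -` ((g ^^ n) -` B)" by (auto simp: funpow_swap1)
  then show ?case
    using Suc invariant[of "(g ^^ n) -` B"] measurable_sets[OF g_funpow_measurable, of B n]
    by (simp del: funpow.simps)
qed simp

text \<open>By invariance, the measure of F is that of its preimage under the n-th iterate, which is the union
of the images of F under the inverse branches of rank n. For large n the density of \<nu> is in
mean close to a function that is constant on each cylinder of rank n, and on each of these the image
has the length of F times a factor that is constant up to 4.\<close>
lemma nu_distortion:
  assumes [measurable]: "E \<in> sets borel" "E' \<in> sets borel" and Y: "E \<subseteq> Y" "E' \<subseteq> Y"
  shows "measure \<nu> E * measure lborel E' \<le> 4 * measure \<nu> E' * measure lborel E"
proof -
  have fin: "finite_measure \<nu>" by unfold_locales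
  obtain D where [measurable]: "D \<in> borel_measurable lborel"
    and RN: "AE x in lborel. RN_deriv lborel \<nu> x = ennreal (D x)" and D0: "\<And>x. 0 \<le> D x"
    by (rule sigma_finite_measure.real_RN_deriv[OF sigma_finite_lborel fin absolutely_continuous]) (simp_all add: sets_nu)
  have "density lborel (\<lambda>x. ennreal (D x)) = density lborel (RN_deriv lborel \<nu>)"
    using RN by (intro density_cong) auto
  also have "\<dots> = \<nu>"
    by (intro sigma_finite_measure.density_RN_deriv sigma_finite_lborel absolutely_continuous) (simp add: sets_nu)
  finally have dens: "\<nu> = density lborel (\<lambda>x. ennreal (D x))" ..
  have "(\<integral>\<^sup>+x. ennreal (D x) \<partial>lborel) = emeasure \<nu> UNIV"
    by (subst dens) (simp add: emeasure_density)
  also have "\<dots> < \<infinity>" by (metis emeasure_finite infinity_ennreal_def top.not_eq_extremum)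
  finally have Dint: "integrable lborel D"
    using D0 by (intro integrableI_nonneg) auto
  have nuD: "measure \<nu> B = (LINT x:B|lborel. D x)" if [measurable]: "B \<in> sets borel" for B
  proof -
    have "measure \<nu> B = (LINT x|\<nu>. indicat_real B x)" by (simp add: sets_nu)
    also have "\<dots> = (LINT x|lborel. D x *\<^sub>R indicat_real B x)"
      by (subst dens, subst integral_density) (use D0 in auto)
    finally show ?thesis by (simp add: set_lebesgue_integral_def mult.commute)
  qed
  have Dset: "set_integrable lborel B D" if "B \<in> sets borel" for B
    unfolding set_integrable_def using Dint that by (intro integrable_mult_indicator) auto

  \<comment> \<open>up to the factor 4, S * lborel is the measure on Y that the piecewise constant density induces\<close>
  have approx: "\<exists>S. \<forall>F\<in>{E, E'}. S * measure lborel F - 2 * e \<le> measure \<nu> F \<and>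
      measure \<nu> F \<le> 4 * S * measure lborel F + 2 * e" if e: "0 < e" for e :: real
  proof -
    obtain k where k: "continuous_on UNIV k" "\<And>x. 0 \<le> k x"
      and kD: "(LINT x:{0..1}|lborel. \<bar>D x - k x\<bar>) < e"
      using integrable_approx_continuous_nonneg[OF Dint D0 e] by auto
    have [measurable]: "k \<in> borel_measurable borel" using k(1) by (rule borel_measurable_continuous_onI)
    have "uniformly_continuous_on {0..1} k"
      using k(1) by (intro compact_uniformly_continuous continuous_on_subset[OF k(1)]) auto
    then obtain d where d: "0 < d"
      "\<And>x y. x \<in> {0..1} \<Longrightarrow> y \<in> {0..1} \<Longrightarrow> dist y x < d \<Longrightarrow> dist (k y) (k x) < e"
      using e unfolding uniformly_continuous_on_def by metis
    obtain n where n: "left_preimage n < d"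
      using LIMSEQ_D[OF left_preimage_tendsto_0 d(1)] by (force simp: abs_less_iff)
    define W where "W = {w :: bool list. length w = n}"
    have finW: "finite W" unfolding W_def by (rule finite_words)
    define S where "S = (\<Sum>w\<in>W. k (word_inverse w 1) * word_weight w 1)"
    have kset: "set_integrable lborel B k" if "B \<in> sets borel" "B \<subseteq> {0..1}" for B
      using that continuous_on_subset[OF k(1), of "{0..1}"]
      by (rule_tac set_integrable_subset[OF borel_integrable_atLeastAtMost'[of 0 1 k]]) auto
    have Rset: "set_integrable lborel B (\<lambda>x. \<bar>D x - k x\<bar>)" if "B \<in> sets borel" "B \<subseteq> {0..1}" for B
      using that Dset kset by (intro set_integrable_abs set_integral_diff) auto
    have "S * measure lborel F - 2 * e \<le> measure \<nu> F \<and>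
      measure \<nu> F \<le> 4 * S * measure lborel F + 2 * e" if F [measurable]: "F \<in> sets borel" and FY: "F \<subseteq> Y" for F
    proof -
      have F01: "F \<subseteq> {0<..1}" using FY by auto
      let ?I = "\<lambda>w. word_inverse w ` F"
      let ?Q = "\<Sum>w\<in>W. k (word_inverse w 1) * measure lborel (?I w)"
      have I: "?I w \<in> sets borel" "?I w \<subseteq> {0<..1}" "?I w \<subseteq> {0..1}" for w
        using word_inverse_image_borel[OF F F01] F01 word_inverse_pos word_inverse_le_1
        by (auto simp: subset_eq less_imp_le)
      have fmI: "?I w \<in> fmeasurable lborel" for w using I fmeasurable_unit by auto
      have un: "(\<Union>w\<in>W. ?I w) = {0<..1} \<inter> (g ^^ n) -` F"
        and dis: "disjoint_family_on ?I W"
        unfolding W_def using word_images_partition[OF F01] by auto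
      have "measure \<nu> F = measure \<nu> ((g ^^ n) -` F)" using invariant_funpow[OF F] by simp
      also have "\<dots> = measure \<nu> (\<Union>w\<in>W. ?I w)"
        unfolding un using measurable_sets[OF g_funpow_measurable, of F n]
        by (subst nu_restrict) (auto simp: Int_commute)
      also have "\<dots> = (\<Sum>w\<in>W. measure \<nu> (?I w))"
        using finW dis I by (intro finite_measure_finite_Union) (auto simp: sets_nu)
      finally have nuF: "measure \<nu> F = (\<Sum>w\<in>W. measure \<nu> (?I w))" .
      have each: "\<bar>measure \<nu> (?I w) - k (word_inverse w 1) * measure lborel (?I w)\<bar>
          \<le> (LINT x:?I w|lborel. \<bar>D x - k x\<bar>) + e * measure lborel (?I w)" if w: "w \<in> W" for w
      proof -
        let ?c = "k (word_inverse w 1)"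
        have const: "set_integrable lborel (?I w) (\<lambda>x. c)" "(LINT x:?I w|lborel. c) = c * measure lborel (?I w)" for c :: real
          using fmI[of w] by (auto simp: set_integrable_def set_lebesgue_integral_def fmeasurable_def)
        have "measure \<nu> (?I w) - ?c * measure lborel (?I w) = (LINT x:?I w|lborel. D x - ?c)"
          using nuD[OF I(1)] const Dset[OF I(1)] by simp
        also have "\<bar>\<dots>\<bar> \<le> (LINT x:?I w|lborel. \<bar>D x - ?c\<bar>)"
          using set_integral_norm_bound[of lborel "?I w" "\<lambda>x. D x - ?c"] Dset[OF I(1)] const by auto
        also have "\<dots> \<le> (LINT x:?I w|lborel. \<bar>D x - k x\<bar> + e)"
        proof (rule set_integral_mono)
          fix x assume "x \<in> ?I w"
          then obtain z where z: "z \<in> F" "x = word_inverse w z" by auto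
          then have "\<bar>x - word_inverse w 1\<bar> \<le> left_preimage n"
            using word_inverse_diameter[of z 1 w] F01 w by (auto simp: W_def)
          then have "dist (k x) ?c < e"
            using n I(3)[of w] z word_inverse_nonneg[of 1 w] word_inverse_le_1[of 1 w]
            by (intro d(2)) (auto simp: dist_real_def)
          then show "\<bar>D x - ?c\<bar> \<le> \<bar>D x - k x\<bar> + e" by (simp add: dist_real_def)
        qed (use Dset[OF I(1)] Rset[OF I(1,3)] const in \<open>auto intro!: set_integrable_abs set_integral_diff set_integral_add\<close>)
        also have "\<dots> = (LINT x:?I w|lborel. \<bar>D x - k x\<bar>) + e * measure lborel (?I w)"
          using Rset[OF I(1,3)] const by simp
        finally show ?thesis .
      qed
      have "\<bar>measure \<nu> F - ?Q\<bar> \<le> (\<Sum>w\<in>W. (LINT x:?I w|lborel. \<bar>D x - k x\<bar>) + e * measure lborel (?I w))"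
        unfolding nuF sum_subtractf[symmetric] using each by (intro order.trans[OF sum_abs] sum_mono) auto
      also have "\<dots> = (LINT x:(\<Union>w\<in>W. ?I w)|lborel. \<bar>D x - k x\<bar>) + e * measure lborel (\<Union>w\<in>W. ?I w)"
      proof -
        have "(\<Sum>w\<in>W. LINT x:?I w|lborel. \<bar>D x - k x\<bar>) = (LINT x:(\<Union>w\<in>W. ?I w)|lborel. \<bar>D x - k x\<bar>)"
          using finW dis I Rset by (intro set_integral_finite_Union[symmetric]) auto
        moreover have "(\<Sum>w\<in>W. measure lborel (?I w)) = measure lborel (\<Union>w\<in>W. ?I w)"
          using finW dis I fmeasurableD2[OF fmI] by (intro measure_finite_Union[symmetric]) auto
        ultimately show ?thesis by (simp add: sum.distrib sum_distrib_left[symmetric])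
      qed
      also have "\<dots> \<le> e + e * 1"
      proof (intro add_mono mult_left_mono)
        have U: "(\<Union>w\<in>W. ?I w) \<in> sets borel" "(\<Union>w\<in>W. ?I w) \<subseteq> {0..1}"
          using finW by (intro sets.finite_UN UN_least I; simp)+
        have "(LINT x:(\<Union>w\<in>W. ?I w)|lborel. \<bar>D x - k x\<bar>) \<le> (LINT x:{0..1}|lborel. \<bar>D x - k x\<bar>)"
          unfolding set_lebesgue_integral_def
        proof (rule integral_mono)
          show "indicat_real (\<Union>w\<in>W. ?I w) x *\<^sub>R \<bar>D x - k x\<bar> \<le> indicat_real {0..1} x *\<^sub>R \<bar>D x - k x\<bar>" for x
            using U(2) by (intro scaleR_right_mono indicator_leI) (erule subsetD, assumption, simp)
        qed (use Rset[OF U] Rset[of "{0..1}"] in \<open>simp_all add: set_integrable_def\<close>)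
        then show "(LINT x:(\<Union>w\<in>W. ?I w)|lborel. \<bar>D x - k x\<bar>) \<le> e" using kD by simp
        have "measure lborel (\<Union>w\<in>W. ?I w) \<le> measure lborel {0..1::real}"
          using U by (intro measure_mono_fmeasurable fmeasurable_unit) auto
        then show "measure lborel (\<Union>w\<in>W. ?I w) \<le> 1" by simp
      qed (use e in auto)
      finally have close: "\<bar>measure \<nu> F - ?Q\<bar> \<le> 2 * e" by simp
      have "S * measure lborel F \<le> ?Q"
        unfolding S_def sum_distrib_right
        using word_inverse_image_measure(1)[OF F FY] k(2)
        by (intro sum_mono) (simp add: mult.assoc mult_left_mono)
      moreover have "?Q \<le> 4 * S * measure lborel F"
        unfolding S_def sum_distrib_right sum_distrib_left
      proof (rule sum_mono)
        fix w
        have "k (word_inverse w 1) * measure lborel (?I w) \<le>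
            k (word_inverse w 1) * (4 * word_weight w 1 * measure lborel F)"
          using word_inverse_image_measure(2)[OF F FY] k(2) by (intro mult_left_mono) auto
        then show "k (word_inverse w 1) * measure lborel (?I w) \<le>
            4 * (k (word_inverse w 1) * word_weight w 1) * measure lborel F" by (simp add: mult_ac)
      qed
      ultimately show ?thesis using close by linarith
    qed
    then show ?thesis using assms by blast
  qed
  have le1: "measure lborel F \<le> 1" if "F \<in> sets borel" "F \<subseteq> Y" for F
  proof -
    have "measure lborel F \<le> measure lborel {0..1::real}"
      using that by (intro measure_mono_fmeasurable fmeasurable_unit) auto
    then show ?thesis by simp
  qed
  show ?thesis
  proof (rule field_le_epsilon)
    fix \<delta> :: real assume "0 < \<delta>"
    \<comment> \<open>the errors below add up to at most 10 e\<close>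
    define e where "e = \<delta> / 10"
    have e: "0 < e" using \<open>0 < \<delta>\<close> by (simp add: e_def)
    obtain S where S: "measure \<nu> E \<le> 4 * S * measure lborel E + 2 * e"
      "S * measure lborel E' - 2 * e \<le> measure \<nu> E'"
      using approx[OF e] by auto
    have "measure \<nu> E * measure lborel E' \<le> (4 * S * measure lborel E + 2 * e) * measure lborel E'"
      using S(1) by (intro mult_right_mono) auto
    also have "\<dots> = 4 * measure lborel E * (S * measure lborel E') + 2 * e * measure lborel E'"
      by (simp add: algebra_simps)
    also have "\<dots> \<le> 4 * measure lborel E * (measure \<nu> E' + 2 * e) + 2 * e * 1"
      using S(2) le1[OF assms(2) Y(2)] e by (intro add_mono mult_left_mono) auto
    also have "\<dots> = 4 * measure \<nu> E' * measure lborel E + 8 * e * measure lborel E + 2 * e"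
      by (simp add: algebra_simps)
    also have "8 * e * measure lborel E \<le> 8 * e * 1"
      using le1[OF assms(1) Y(1)] e by (intro mult_left_mono) auto
    finally show "measure \<nu> E * measure lborel E' \<le> 4 * measure \<nu> E' * measure lborel E + \<delta>"
      by (simp add: e_def)
  qed
qed

text \<open>The set of points that are sent to (0, a k] consists of (0, a (k + 1)] and an interval of half the length
that is adjacent to 1/2.\<close>
lemma nu_near_zero:
  "measure \<nu> {0<..left_preimage k} = measure \<nu> {0<..left_preimage (Suc k)} + measure \<nu> {1/2<..(1 + left_preimage k) / 2}"
proof -
  have k: "0 < left_preimage k" "left_preimage k \<le> 1" by (rule left_preimage_pos left_preimage_le_1)+
  have half: "left_preimage (Suc k) \<le> 1/2"
    using left_preimage_antimono[of 1 "Suc k"] by (simp add: left_preimage_Suc)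
  have "(\<Union>w\<in>{w. length w = 1}. word_inverse w ` {0<..left_preimage k}) = {0<..1} \<inter> (g ^^ 1) -` {0<..left_preimage k}"
    using k by (intro word_images_partition) auto
  moreover have "{w :: bool list. length w = 1} = {[False], [True]}"
    by (auto simp: length_Suc_conv)
  moreover have "word_inverse [False] ` {0<..left_preimage k} = {0<..left_preimage (Suc k)}"
    "word_inverse [True] ` {0<..left_preimage k} = {1/2<..(1 + left_preimage k) / 2}"
    using word_inverse_image[of 0 "left_preimage k" "[False]"] word_inverse_image[of 0 "left_preimage k" "[True]"] k
    by (simp_all add: branch_inverse_def left_preimage_Suc)
  ultimately have eq: "g -` {0<..left_preimage k} \<inter> {0<..1} = {0<..left_preimage (Suc k)} \<union> {1/2<..(1 + left_preimage k) / 2}"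
    by (simp add: Int_commute)
  have "measure \<nu> {0<..left_preimage k} = measure \<nu> (g -` {0<..left_preimage k})"
    by (simp add: invariant)
  also have "\<dots> = measure \<nu> ({0<..left_preimage (Suc k)} \<union> {1/2<..(1 + left_preimage k) / 2})"
    using measurable_sets[OF g_measurable, of "{0<..left_preimage k}"] by (subst nu_restrict) (auto simp: eq)
  also have "\<dots> = measure \<nu> {0<..left_preimage (Suc k)} + measure \<nu> {1/2<..(1 + left_preimage k) / 2}"
    using half by (intro finite_measure_Union) (auto simp: sets_nu)
  finally show ?thesis .
qed

text \<open>Otherwise the intervals (0, a k], which shrink to the empty set, would all have full measure.\<close>
lemma nu_Y_pos: "0 < measure \<nu> Y"
proof (rule ccontr)
  assume "\<not> 0 < measure \<nu> Y"
  then have Y0: "measure \<nu> Y = 0" using measure_nonneg[of \<nu> Y] by linarith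
  have "measure \<nu> {1/2<..(1 + left_preimage k) / 2} = 0" for k
  proof -
    have "measure \<nu> {1/2<..(1 + left_preimage k) / 2} \<le> measure \<nu> Y"
      using left_preimage_le_1[of k] by (intro finite_measure_mono) (auto simp: sets_nu)
    then show ?thesis by (simp add: Y0 measure_le_0_iff)
  qed
  then have "measure \<nu> {0<..left_preimage (Suc k)} = measure \<nu> {0<..left_preimage k}" for k
    using nu_near_zero[of k] by simp
  then have "measure \<nu> {0<..left_preimage k} = measure \<nu> {0<..left_preimage 0}" for k
    by (induction k) (simp_all only:)
  moreover have "measure \<nu> {0<..left_preimage 0} = 1"
    using nu_restrict[of UNIV] prob_space sets_eq_imp_space_eq[OF sets_nu] by simp
  ultimately have "(\<lambda>k. measure \<nu> {0<..left_preimage k}) \<longlonglongrightarrow> 1" by simp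
  moreover have "(\<lambda>k. measure \<nu> {0<..left_preimage k}) \<longlonglongrightarrow> measure \<nu> (\<Inter>k. {0<..left_preimage k})"
  proof (rule finite_Lim_measure_decseq)
    show "decseq (\<lambda>k. {0<..left_preimage k})"
      unfolding decseq_Suc_iff
    proof (intro allI subsetI)
      fix k x assume "x \<in> {0<..left_preimage (Suc k)}"
      then show "x \<in> {0<..left_preimage k}" using left_preimage_Suc_le[of k] by simp
    qed
  qed (auto simp: sets_nu)
  moreover have "(\<Inter>k. {0<..left_preimage k}) = {}"
  proof (intro equals0I)
    fix x assume x: "x \<in> (\<Inter>k. {0<..left_preimage k})"
    then have "x \<le> 0" by (intro LIMSEQ_le_const[OF left_preimage_tendsto_0]) auto
    with x show False by auto
  qed
  ultimately have "(\<lambda>k. measure \<nu> {0<..left_preimage k}) \<longlonglongrightarrow> 1"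
    "(\<lambda>k. measure \<nu> {0<..left_preimage k}) \<longlonglongrightarrow> 0"
    by simp_all
  from LIMSEQ_unique[OF this] show False by simp
qed

text \<open>The n terms between n and 2 n of the telescoping sum are each at least of order a (2 n), because \<nu> is
comparable to Lebesgue measure on Y.\<close>
lemma nu_near_zero_lower:
  obtains c where "0 < c" "\<And>n. 1 \<le> n \<Longrightarrow> c * real n powr (1 - 1/\<alpha>) \<le> measure \<nu> {0<..left_preimage n}"
proof
  define b where "b = measure \<nu> Y / 4"
  have b: "0 < b" using nu_Y_pos by (simp add: b_def)
  let ?c = "b * (1 / 3) powr (1/\<alpha>) * 2 powr (- (1/\<alpha>))"
  show "0 < ?c" using b by simp
  have slice: "b * left_preimage k \<le> measure \<nu> {1/2<..(1 + left_preimage k) / 2}" for k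
  proof -
    have "measure \<nu> Y * measure lborel {1/2<..(1 + left_preimage k) / 2} \<le>
        4 * measure \<nu> {1/2<..(1 + left_preimage k) / 2} * measure lborel Y"
      using left_preimage_le_1[of k] by (intro nu_distortion) auto
    moreover have "measure lborel {1/2<..(1 + left_preimage k) / 2} = left_preimage k / 2"
      using left_preimage_pos[of k] by (subst measure_lborel_Ioc) (auto simp: field_simps)
    ultimately show ?thesis by (simp add: b_def)
  qed
  show "?c * real n powr (1 - 1/\<alpha>) \<le> measure \<nu> {0<..left_preimage n}" if n: "1 \<le> n" for n
  proof -
    have sum: "real j * (b * left_preimage (n + j)) \<le> measure \<nu> {0<..left_preimage n} - measure \<nu> {0<..left_preimage (n + j)}" for j
    proof (induction j)
      case (Suc j)
      have "real (Suc j) * (b * left_preimage (n + Suc j)) = real j * (b * left_preimage (n + Suc j)) + b * left_preimage (n + Suc j)"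
        by (simp add: algebra_simps)
      also have "\<dots> \<le> real j * (b * left_preimage (n + j)) + b * left_preimage (n + j)"
        using b left_preimage_Suc_le[of "n + j"] by (intro add_mono mult_left_mono) auto
      also have "\<dots> \<le> measure \<nu> {0<..left_preimage n} - measure \<nu> {0<..left_preimage (n + Suc j)}"
        using Suc slice[of "n + j"] nu_near_zero[of "n + j"] by simp
      finally show ?case .
    qed simp
    have "?c * real n powr (1 - 1/\<alpha>) = real n * (b * ((1 / 3) powr (1/\<alpha>) * real (n + n) powr (- (1/\<alpha>))))"
    proof -
      have "real n powr (1 - 1/\<alpha>) = real n * real n powr (- (1/\<alpha>))"
        using n by (simp add: powr_diff powr_minus divide_inverse)
      moreover have "real (n + n) powr (- (1/\<alpha>)) = 2 powr (- (1/\<alpha>)) * real n powr (- (1/\<alpha>))"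
        using powr_mult[of 2 "real n" "- (1/\<alpha>)"] by simp
      ultimately show ?thesis by simp
    qed
    also have "\<dots> \<le> real n * (b * left_preimage (n + n))"
      using n b left_preimage_lower[of "n + n"] by (intro mult_left_mono) auto
    also have "\<dots> \<le> measure \<nu> {0<..left_preimage n}"
      using sum[of n] measure_nonneg[of \<nu> "{0<..left_preimage (n + n)}"] by linarith
    finally show ?thesis .
  qed
qed

text \<open>The measures of the sets of points that avoid K for n and for n + 1 steps differ by
the measure of the points of K that avoid K for n steps, which escape_tail bounds by a multiple of n powr (-1/\<alpha>). Summing
these differences gives the claim, provided that the measures tend to 0: almost every point
that never meets K again enters Y, where the set of such points is null by escape_tail.\<close>
lemma nu_escape_upper:
  fixes ws :: "bool list"
  defines "K \<equiv> word_inverse (True # ws) ` {0<..1}"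
  obtains C where "0 < C" "\<And>n. 1 \<le> n \<Longrightarrow> measure \<nu> (avoids K n) \<le> C * real n powr (1 - 1/\<alpha>)"
proof -
  define \<beta> where "\<beta> = 1/\<alpha>"
  have \<beta>: "1 < \<beta>" using alpha_pos alpha_less_1 by (simp add: \<beta>_def)
  have K_borel [measurable]: "K \<in> sets borel"
    unfolding K_def by (intro word_inverse_image_borel) auto
  have K_Y: "K \<subseteq> Y"
    unfolding K_def using word_inverse_pos[of _ ws] word_inverse_le_1[of _ ws]
    by (fastforce simp: branch_inverse_def)
  obtain A where A: "0 < A"
    "\<And>n w. 1 \<le> n \<Longrightarrow> measure lborel (word_inverse w ` (Y \<inter> avoids K n))
       \<le> A * real n powr (- (1/\<alpha>)) * cylinder_length (w @ [True])"
    unfolding K_def by (rule escape_tail[of "True # ws"]) blast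
  have nuY: "measure \<nu> (Y \<inter> avoids K n) \<le> 4 * A * real n powr (-\<beta>)" if n: "1 \<le> n" for n
  proof -
    have "measure \<nu> (Y \<inter> avoids K n) * measure lborel Y \<le> 4 * measure \<nu> Y * measure lborel (Y \<inter> avoids K n)"
      by (intro nu_distortion) auto
    also have "\<dots> \<le> 4 * 1 * (A * real n powr (-\<beta>) * (1/2))"
      using A(2)[OF n, of "[]"] prob_le_1[of Y]
      by (intro mult_mono) (auto simp: \<beta>_def cylinder_length_def branch_inverse_def)
    finally show ?thesis by simp
  qed
  have Kac: "measure \<nu> (avoids K n) - measure \<nu> (avoids K (Suc n)) = measure \<nu> (K \<inter> avoids K n)" for n
  proof -
    have "avoids K (Suc n) = g -` (avoids K n - K)"
    proof (intro set_eqI iffI)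
      fix x assume x: "x \<in> avoids K (Suc n)"
      have "(g ^^ i) (g x) \<notin> K" if "i \<le> n" for i
      proof -
        have "(g ^^ Suc i) x \<notin> K" using x that unfolding avoids_def by (auto simp del: funpow.simps)
        then show ?thesis by (simp add: funpow_swap1)
      qed
      from this this[of 0] show "x \<in> g -` (avoids K n - K)" by (auto simp: avoids_def)
    next
      fix x assume x: "x \<in> g -` (avoids K n - K)"
      have "(g ^^ i) x \<notin> K" if "i \<in> {1..Suc n}" for i
      proof -
        obtain j where j: "i = Suc j" "j \<le> n" using \<open>i \<in> {1..Suc n}\<close> by (cases i) auto
        have "(g ^^ j) (g x) \<notin> K" using x j(2) by (cases "j = 0") (auto simp: avoids_def)
        then show ?thesis using j(1) by (simp add: funpow_swap1)
      qed
      then show "x \<in> avoids K (Suc n)" by (simp add: avoids_def)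
    qed
    then have "measure \<nu> (avoids K (Suc n)) = measure \<nu> (avoids K n - K)"
      by (simp add: invariant)
    also have "\<dots> = measure \<nu> (avoids K n) - measure \<nu> (avoids K n \<inter> K)"
      by (intro finite_measure_Diff') (auto simp: sets_nu)
    finally show ?thesis by (simp add: Int_commute)
  qed
  define C where "C = 4 * A * (2 powr \<beta> / (\<beta> - 1))"
  have C: "0 < C" using A(1) \<beta> by (simp add: C_def)
  \<comment> \<open>F increases to 0, so it is nowhere positive\<close>
  define F where "F = (\<lambda>n. measure \<nu> (avoids K n) - C * real n powr (1 - \<beta>))"
  have F_mono: "F n \<le> F (Suc n)" if n: "1 \<le> n" for n
  proof -
    have "measure \<nu> (K \<inter> avoids K n) \<le> measure \<nu> (Y \<inter> avoids K n)"
      using K_Y by (intro finite_measure_mono) (auto simp: sets_nu)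
    also have "\<dots> \<le> 4 * A * real n powr (-\<beta>)" by (rule nuY[OF n])
    also have "\<dots> \<le> 4 * A * (2 powr \<beta> / (\<beta> - 1) * (real n powr (1 - \<beta>) - real (Suc n) powr (1 - \<beta>)))"
      using A(1) powr_difference_lower[OF n \<beta>] by (intro mult_left_mono) auto
    finally show ?thesis using Kac[of n] by (simp add: F_def C_def algebra_simps)
  qed
  have dec: "decseq (avoids K)" by (auto simp: decseq_def avoids_def)
  let ?D = "\<Inter>n. avoids K n"
  have D_borel [measurable]: "?D \<in> sets borel" by auto
  have "measure \<nu> (Y \<inter> ?D) \<le> 0"
  proof (rule LIMSEQ_le_const)
    show "(\<lambda>n. 4 * A * real n powr (-\<beta>)) \<longlonglongrightarrow> 0"
      using \<beta> by (intro tendsto_mult_right_zero tendsto_neg_powr filterlim_real_sequentially) auto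
    have "measure \<nu> (Y \<inter> ?D) \<le> 4 * A * real n powr (-\<beta>)" if "1 \<le> n" for n
      by (rule order.trans[OF finite_measure_mono nuY[OF that]]) (auto simp: sets_nu)
    then show "\<exists>N. \<forall>n\<ge>N. measure \<nu> (Y \<inter> ?D) \<le> 4 * A * real n powr (-\<beta>)" by blast
  qed
  then have YD0: "measure \<nu> (Y \<inter> ?D) = 0" using measure_nonneg[of \<nu> "Y \<inter> ?D"] by linarith
  have "?D \<inter> {0<..1} \<subseteq> (\<Union>k. (g ^^ k) -` (Y \<inter> ?D))"
  proof
    fix x assume x: "x \<in> ?D \<inter> {0<..1}"
    then obtain m where "left_preimage (Suc m) < x"
      using order_tendstoD(2)[OF LIMSEQ_Suc[OF left_preimage_tendsto_0], of x]
      by (auto simp: eventually_sequentially)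
    then obtain k where k: "(g ^^ k) x \<in> Y" using first_entry[of x m] x by auto
    have "(g ^^ i) ((g ^^ k) x) \<notin> K" if "1 \<le> i" for i
    proof -
      have "x \<in> avoids K (i + k)" using x by blast
      then have "(g ^^ (i + k)) x \<notin> K" using that by (simp add: avoids_def)
      then show ?thesis by (simp add: funpow_add)
    qed
    with k have "x \<in> (g ^^ k) -` (Y \<inter> ?D)" by (auto simp: avoids_def)
    then show "x \<in> (\<Union>k. (g ^^ k) -` (Y \<inter> ?D))" by blast
  qed
  moreover have "(\<Union>k. (g ^^ k) -` (Y \<inter> ?D)) \<in> null_sets \<nu>"
  proof (intro null_sets_UN)
    fix k
    have "(g ^^ k) -` (Y \<inter> ?D) \<in> sets borel"
      using measurable_sets[OF g_funpow_measurable, of "Y \<inter> ?D" k] by simp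
    moreover have "measure \<nu> ((g ^^ k) -` (Y \<inter> ?D)) = 0" using YD0 by (subst invariant_funpow) auto
    ultimately show "(g ^^ k) -` (Y \<inter> ?D) \<in> null_sets \<nu>"
      by (auto simp: null_sets_def sets_nu emeasure_eq_measure)
  qed
  ultimately have "measure \<nu> (?D \<inter> {0<..1}) = 0"
    using null_sets_subset[of _ \<nu> "?D \<inter> {0<..1}"] by (auto simp: sets_nu intro!: measure_eq_0_null_sets)
  then have "measure \<nu> ?D = 0" using nu_restrict[OF D_borel] by simp
  moreover have "(\<lambda>n. measure \<nu> (avoids K n)) \<longlonglongrightarrow> measure \<nu> ?D"
    using dec by (intro finite_Lim_measure_decseq) (auto simp: sets_nu)
  moreover have "(\<lambda>n. C * real n powr (1 - \<beta>)) \<longlonglongrightarrow> 0"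
    using \<beta> by (intro tendsto_mult_right_zero tendsto_neg_powr filterlim_real_sequentially) auto
  ultimately have "F \<longlonglongrightarrow> 0 - 0" unfolding F_def by (intro tendsto_diff) auto
  have "F n \<le> 0" if n: "1 \<le> n" for n
  proof (rule LIMSEQ_le_const)
    show "F \<longlonglongrightarrow> 0" using \<open>F \<longlonglongrightarrow> 0 - 0\<close> by simp
    have "F n \<le> F m" if "n \<le> m" for m
      using that by (induction m rule: dec_induct) (use n F_mono in \<open>auto intro: order.trans\<close>)
    then show "\<exists>N. \<forall>m\<ge>N. F n \<le> F m" by blast
  qed
  then show thesis using C by (intro that[of C]) (auto simp: F_def \<beta>_def)
qed

end

section \<open>The attractor of the solenoid map\<close>
definition circle :: "real \<Rightarrow> complex" where
  "circle x = 1/2 * exp (2 * of_real pi * \<i> * of_real x)"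

lemma circle_dist: "norm (circle x - circle y) = \<bar>sin (pi * (x - y))\<bar>"
proof -
  have "circle x - circle y = 1/2 * exp (2 * of_real pi * \<i> * of_real y) * (exp (\<i> * of_real (2 * pi * (x - y))) - 1)"
    by (simp add: circle_def algebra_simps flip: exp_add)
  then have "norm (circle x - circle y) = norm (1/2 :: complex) *
      norm (exp (2 * of_real pi * \<i> * of_real y)) * norm (exp (\<i> * of_real (2 * pi * (x - y))) - 1)"
    by (simp only: norm_mult)
  moreover have "norm (exp (2 * of_real pi * \<i> * of_real y)) = 1"
    by (simp add: norm_exp_eq_Re)
  ultimately show ?thesis unfolding dist_exp_i_1 by simp
qed

lemma circle_lipschitz: "norm (circle x - circle y) \<le> pi * \<bar>x - y\<bar>"
  using abs_sin_x_le_abs_x[of "pi * (x - y)"] by (simp add: circle_dist abs_mult)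

lemma norm_circle: "norm (circle x) = 1/2"
  by (simp add: circle_def norm_mult norm_exp_eq_Re)

text \<open>The two preimages of a point under g differ by at least 1/4 and at most 1/2, so this keeps the images of the
two branches of the solenoid map apart, whose fibres are disks of radius \<theta> < 1/3.\<close>
lemma circle_separation:
  assumes "1/4 \<le> x - y" "x - y \<le> 1/2"
  shows "2/3 < norm (circle x - circle y)"
proof -
  have "sin (pi / 4) \<le> sin (pi * (x - y))"
  proof (rule sin_monotone_2pi_le)
    show "pi / 4 \<le> pi * (x - y)" using mult_left_mono[OF assms(1), of pi] by simp
    show "pi * (x - y) \<le> pi / 2" using mult_left_mono[OF assms(2), of pi] by simp
    show "- (pi / 2) \<le> pi / 4" using pi_gt_zero by linarith
  qed
  moreover have "4 / 3 < sqrt 2" by (rule real_less_rsqrt) (simp add: power2_eq_square)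
  ultimately show ?thesis by (simp add: circle_dist sin_45)
qed

locale solenoid_map = intermittent_map +
  fixes \<theta> :: real
  assumes theta_pos: "0 < \<theta>" and theta_less: "\<theta> < 1/3"
begin

abbreviation F :: "real \<times> complex \<Rightarrow> real \<times> complex" where "F \<equiv> solenoid \<alpha> \<theta>"

abbreviation X :: "(real \<times> complex) set" where "X \<equiv> attractor F solenoid_domain"

lemma F_eq: "F (x, z) = (g x, of_real \<theta> * z + circle x)"
  by (simp add: solenoid_def circle_def)

text \<open>The iterates of the solenoid map send a fibre to a disk with this centre; the word is the itinerary, and the
argument is the first coordinate of the image.\<close>
primrec centre :: "bool list \<Rightarrow> real \<Rightarrow> complex" where
  "centre [] x = 0"
| "centre (b # w) x = of_real (\<theta> ^ length w) * circle (word_inverse (b # w) x) + centre w x"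

lemma centre_snoc:
  "centre (w @ [b]) x = of_real \<theta> * centre w (branch_inverse b x) + circle (branch_inverse b x)"
  by (induction w) (simp_all add: word_inverse_append algebra_simps)

lemma F_funpow:
  assumes "0 \<le> y" "y \<le> 1"
  shows "(F ^^ n) (y, \<zeta>) = ((g ^^ n) y, of_real (\<theta> ^ n) * \<zeta> + centre (itinerary n y) ((g ^^ n) y))"
  using assms
proof (induction n arbitrary: y \<zeta>)
  case (Suc n)
  have "(F ^^ Suc n) (y, \<zeta>) = (F ^^ n) (F (y, \<zeta>))" by (simp add: funpow_swap1)
  then show ?case
    using Suc g_unit[of y] word_inverse_itinerary[of y "Suc n"]
    by (simp add: F_eq funpow_swap1 algebra_simps)
qed simp

lemma fst_F_funpow: "0 \<le> fst p \<Longrightarrow> fst p \<le> 1 \<Longrightarrow> fst ((F ^^ n) p) = (g ^^ n) (fst p)"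
  using F_funpow[of "fst p" n "snd p"] by simp

lemma centre_lipschitz:
  assumes "0 \<le> x" "x \<le> 1" "0 \<le> y" "y \<le> 1"
  shows "norm (centre w x - centre w y) \<le> pi / (1 - \<theta>) * \<bar>x - y\<bar>"
proof -
  have "norm (centre w x - centre w y) \<le> pi / (1 - \<theta>) * (1 - \<theta> ^ length w) * \<bar>x - y\<bar>"
  proof (induction w)
    case (Cons b w)
    let ?x = "word_inverse (b # w) x" and ?y = "word_inverse (b # w) y"
    have "norm (of_real (\<theta> ^ length w) * (circle ?x - circle ?y)) = \<theta> ^ length w * norm (circle ?x - circle ?y)"
      using theta_pos by (simp add: norm_mult norm_power)
    also have "\<dots> \<le> \<theta> ^ length w * (pi * \<bar>x - y\<bar>)"
      using theta_pos word_inverse_lipschitz[OF assms, of "b # w"]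
      by (intro mult_left_mono order.trans[OF circle_lipschitz]) auto
    finally have "norm (of_real (\<theta> ^ length w) * (circle ?x - circle ?y)) \<le> \<theta> ^ length w * (pi * \<bar>x - y\<bar>)" .
    moreover have "centre (b # w) x - centre (b # w) y =
        of_real (\<theta> ^ length w) * (circle ?x - circle ?y) + (centre w x - centre w y)"
      by (simp add: algebra_simps)
    ultimately have "norm (centre (b # w) x - centre (b # w) y) \<le>
        \<theta> ^ length w * (pi * \<bar>x - y\<bar>) + pi / (1 - \<theta>) * (1 - \<theta> ^ length w) * \<bar>x - y\<bar>"
      using Cons by (simp only: norm_triangle_mono)
    also have "\<dots> = pi / (1 - \<theta>) * (1 - \<theta> ^ length (b # w)) * \<bar>x - y\<bar>"
      using theta_less by (simp add: field_simps)
    finally show ?case .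
  qed simp
  also have "\<dots> \<le> pi / (1 - \<theta>) * 1 * \<bar>x - y\<bar>"
    using theta_pos theta_less by (intro mult_right_mono mult_left_mono) auto
  finally show ?thesis by simp
qed

text \<open>The bound is chosen to complement the radius of the tube, so that all tubes lie over the unit disk.\<close>
lemma norm_centre: "norm (centre w x) \<le> 1 - \<theta> ^ length w"
proof (induction w)
  case (Cons b w)
  have "norm (centre (b # w) x) \<le> \<theta> ^ length w * (1/2) + (1 - \<theta> ^ length w)"
    using Cons norm_triangle_ineq[of "of_real (\<theta> ^ length w) * circle (word_inverse (b # w) x)" "centre w x"] theta_pos
    by (simp add: norm_mult norm_power norm_circle)
  also have "\<dots> \<le> 1 - \<theta> ^ length (b # w)"
    using theta_pos theta_less mult_right_mono[of \<theta> "1/2" "\<theta> ^ length w"] by simp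
  finally show ?case .
qed simp

definition tube :: "bool list \<Rightarrow> (real \<times> complex) set" where
  "tube w = {(x, z). 0 \<le> x \<and> x \<le> 1 \<and> norm (z - centre w x) \<le> \<theta> ^ length w}"

lemma closed_tube: "closed (tube w)"
proof -
  have "(pi / (1 - \<theta>))-lipschitz_on {0..1} (centre w)"
    using centre_lipschitz theta_less
    by (intro lipschitz_onI) (auto simp: dist_norm)
  then have "continuous_on {0..1} (centre w)" by (rule lipschitz_on_continuous_on)
  then have "continuous_on ({0..1} \<times> UNIV) (\<lambda>p::real \<times> complex. centre w (fst p))"
    by (rule continuous_on_compose2) (auto intro: continuous_on_fst continuous_on_id)
  then have "continuous_on ({0..1} \<times> UNIV) (\<lambda>p. snd p - centre w (fst p))"
    by (intro continuous_on_diff continuous_on_snd continuous_on_id)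
  then have "closed (({0..1} \<times> UNIV) \<inter> (\<lambda>p. snd p - centre w (fst p)) -` cball 0 (\<theta> ^ length w))"
    by (rule continuous_closed_preimage) (auto intro: closed_Times)
  also have "({0..1} \<times> UNIV) \<inter> (\<lambda>p. snd p - centre w (fst p)) -` cball 0 (\<theta> ^ length w) = tube w"
    by (auto simp: tube_def)
  finally show ?thesis .
qed

lemma funpow_image_tubes: "(F ^^ n) ` solenoid_domain \<subseteq> (\<Union>w\<in>{w. length w = n}. tube w)"
proof
  fix p assume "p \<in> (F ^^ n) ` solenoid_domain"
  then obtain y \<zeta> where y: "0 \<le> y" "y \<le> 1" "norm \<zeta> \<le> 1" "p = (F ^^ n) (y, \<zeta>)"
    by (auto simp: solenoid_domain_def)
  have "norm (of_real (\<theta> ^ n) * \<zeta>) \<le> \<theta> ^ n"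
    using y(3) theta_pos by (simp add: norm_mult norm_power mult_left_le)
  then have "p \<in> tube (itinerary n y)"
    using g_funpow_unit[OF y(1,2), of n] unfolding y(4) F_funpow[OF y(1,2)] tube_def by simp
  then show "p \<in> (\<Union>w\<in>{w. length w = n}. tube w)" by (intro UN_I[of "itinerary n y"]) auto
qed

text \<open>The last letter of a word is the branch applied last, and undoing it leads to the tube of the shorter
word.\<close>
lemma tube_snocD:
  assumes "(x, z) \<in> tube (w @ [b])"
  shows "(branch_inverse b x, (z - circle (branch_inverse b x)) / of_real \<theta>) \<in> tube w"
    and "norm (z - circle (branch_inverse b x)) \<le> \<theta>"
proof -
  let ?y = "branch_inverse b x" and ?u = "(z - circle (branch_inverse b x)) / of_real \<theta>"
  have x: "0 \<le> x" "x \<le> 1" and z: "norm (z - centre (w @ [b]) x) \<le> \<theta> ^ Suc (length w)"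
    using assms by (auto simp: tube_def)
  have "of_real \<theta> * ?u = z - circle ?y" using theta_pos by simp
  then have "z - centre (w @ [b]) x = of_real \<theta> * (?u - centre w ?y)"
    by (simp only: centre_snoc right_diff_distrib) simp
  then have "\<theta> * norm (?u - centre w ?y) \<le> \<theta> * \<theta> ^ length w"
    using z theta_pos by (simp add: norm_mult)
  then have u: "norm (?u - centre w ?y) \<le> \<theta> ^ length w" using theta_pos by simp
  then show "(?y, ?u) \<in> tube w"
    using x branch_inverse_nonneg[of x b] branch_inverse_le_1[of x b] by (simp add: tube_def)
  have "norm ?u \<le> 1"
    using u norm_centre[of w ?y] norm_triangle_ineq[of "?u - centre w ?y" "centre w ?y"] by simp
  then show "norm (z - circle ?y) \<le> \<theta>" using theta_pos by (simp add: norm_divide field_simps)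
qed

lemma branch_gap:
  assumes "0 \<le> x" "x \<le> 1"
  shows "1/4 \<le> branch_inverse True x - branch_inverse False x"
    and "branch_inverse True x - branch_inverse False x \<le> 1/2"
  using assms half_le_left_inverse[of x] left_inverse_le[of x] left_inverse_le_iff[of x 1]
  by (auto simp: branch_inverse_def field_simps)

lemma tubes_disjoint:
  assumes "length v = length w" "v \<noteq> w"
  shows "tube v \<inter> tube w = {}"
proof -
  have "(x, z) \<in> tube v \<Longrightarrow> (x, z) \<in> tube w \<Longrightarrow> length v = length w \<Longrightarrow> v = w" for x z
  proof (induction v arbitrary: w x z rule: rev_induct)
    case (snoc b v)
    then obtain w' c where w: "w = w' @ [c]" "length v = length w'"
      by (cases w rule: rev_cases) auto
    have x: "0 \<le> x" "x \<le> 1" using snoc.prems by (auto simp: tube_def)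
    have v: "(x, z) \<in> tube (v @ [b])" and w': "(x, z) \<in> tube (w' @ [c])" using snoc.prems w by auto
    show ?case
    proof (cases "b = c")
      case True
      have "v = w'" using snoc.IH[OF tube_snocD(1)[OF v]] tube_snocD(1)[OF w'] True w(2) by simp
      then show ?thesis using w True by simp
    next
      case False
      have "norm (circle (branch_inverse True x) - circle (branch_inverse False x)) =
          norm (circle (branch_inverse b x) - circle (branch_inverse c x))"
        using False by (cases b; cases c) (auto simp: norm_minus_commute)
      also have "\<dots> \<le> norm (z - circle (branch_inverse b x)) + norm (z - circle (branch_inverse c x))"
        using norm_triangle_ineq4[of "z - circle (branch_inverse c x)" "z - circle (branch_inverse b x)"]
        by simp
      also have "\<dots> \<le> 2/3" using tube_snocD(2)[OF v] tube_snocD(2)[OF w'] theta_less by simp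
      finally show ?thesis using circle_separation[OF branch_gap[OF x]] by simp
    qed
  qed simp
  then show ?thesis using assms by auto
qed

lemma connected_in_one_tube:
  assumes C: "connected C" "C \<noteq> {}" "C \<subseteq> (F ^^ n) ` solenoid_domain"
  obtains w where "length w = n" "C \<subseteq> tube w"
proof -
  have cov: "C \<subseteq> (\<Union>w\<in>{w. length w = n}. tube w)" using C(3) funpow_image_tubes by blast
  then obtain p w where w: "p \<in> C" "p \<in> tube w" "length w = n" using C(2) by blast
  let ?B = "\<Union>v\<in>{v. length v = n} - {w}. tube v"
  have "tube w \<inter> C = {} \<or> ?B \<inter> C = {}"
  proof (rule connected_closedD[OF C(1)])
    show "tube w \<inter> ?B \<inter> C = {}" using tubes_disjoint[of _ w] w(3) by fastforce
    show "C \<subseteq> tube w \<union> ?B" using cov by blast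
    show "closed ?B" using finite_words[of n] closed_tube by (intro closed_UN) auto
  qed (rule closed_tube)
  then have "C \<subseteq> tube w" using w cov by blast
  with w(3) show thesis by (rule that)
qed

text \<open>For every n the set lies in one tube of rank n, which is a \<theta> ^ n-neighbourhood of a graph
whose Lipschitz constant does not depend on n.\<close>
lemma connected_lipschitz_graph:
  assumes C: "connected C" "C \<subseteq> X" and p: "p \<in> C" "q \<in> C"
  shows "norm (snd p - snd q) \<le> pi / (1 - \<theta>) * \<bar>fst p - fst q\<bar>"
proof (rule LIMSEQ_le_const)
  let ?L = "pi / (1 - \<theta>) * \<bar>fst p - fst q\<bar>"
  have "(\<lambda>n. 2 * \<theta> ^ n + ?L) \<longlonglongrightarrow> 2 * 0 + ?L"
    using theta_pos theta_less by (intro tendsto_intros LIMSEQ_power_zero) auto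
  then show "(\<lambda>n. 2 * \<theta> ^ n + ?L) \<longlonglongrightarrow> ?L" by simp
  have "norm (snd p - snd q) \<le> 2 * \<theta> ^ n + ?L" for n
  proof -
    have "C \<subseteq> (F ^^ n) ` solenoid_domain" using C(2) unfolding attractor_def by blast
    then obtain w where w: "length w = n" "C \<subseteq> tube w"
      using connected_in_one_tube[OF C(1)] p by blast
    have "p \<in> tube w" "q \<in> tube w" using w(2) p by auto
    then have t: "0 \<le> fst p" "fst p \<le> 1" "norm (snd p - centre w (fst p)) \<le> \<theta> ^ n"
       "0 \<le> fst q" "fst q \<le> 1" "norm (snd q - centre w (fst q)) \<le> \<theta> ^ n"
      using w(1) by (auto simp: tube_def case_prod_beta)
    have "snd p - snd q = (snd p - centre w (fst p)) - (snd q - centre w (fst q))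
        + (centre w (fst p) - centre w (fst q))" by simp
    then have "norm (snd p - snd q) \<le> norm (snd p - centre w (fst p)) + norm (snd q - centre w (fst q))
        + norm (centre w (fst p) - centre w (fst q))"
      by (metis norm_triangle_le norm_triangle_ineq4 add_right_mono)
    then show ?thesis using t centre_lipschitz[of "fst p" "fst q" w] by linarith
  qed
  then show "\<exists>N. \<forall>n\<ge>N. norm (snd p - snd q) \<le> 2 * \<theta> ^ n + ?L" by blast
qed

text \<open>By the Lipschitz property the second component of the velocity is bounded by a multiple of the first, so a
vertical velocity would be zero.\<close>
lemma regular_arc_transversal:
  assumes \<gamma>: "regular_arc \<gamma>" "path_image \<gamma> \<subseteq> X"
    and t: "t \<in> {0..1}" and D: "(\<gamma> has_vector_derivative D) (at t)"
  shows "fst D \<noteq> 0"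
proof
  assume D0: "fst D = 0"
  let ?L = "pi / (1 - \<theta>)"
  \<comment> \<open>the remainder of the first-order expansion at t, divided by the distance to t\<close>
  define R where "R = (\<lambda>y. (1 / norm (y - t)) *\<^sub>R (\<gamma> y - (\<gamma> t + (y - t) *\<^sub>R D)))"
  have "(\<gamma> has_derivative (\<lambda>h. h *\<^sub>R D)) (at t within {0..1})"
    using has_vector_derivative_at_within[OF D] by (simp add: has_vector_derivative_def)
  then have R: "(R \<longlongrightarrow> 0) (at t within {0..1})"
    unfolding has_derivative_within R_def by simp
  have "connected (path_image \<gamma>)"
    using \<gamma>(1) unfolding regular_arc_def arc_def by (intro connected_path_image) auto
  then have lip: "norm (snd (\<gamma> y) - snd (\<gamma> t)) \<le> ?L * \<bar>fst (\<gamma> y) - fst (\<gamma> t)\<bar>" if "y \<in> {0..1}" for y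
    using that t \<gamma>(2) by (intro connected_lipschitz_graph) (auto simp: path_image_def)
  have bound: "norm (snd D) \<le> norm (snd (R y)) + ?L * norm (fst (R y))" if y: "y \<in> {0..1}" "y \<noteq> t" for y
  proof -
    have "(1 / (y - t)) *\<^sub>R (snd (\<gamma> y) - snd (\<gamma> t)) - (1 / (y - t)) *\<^sub>R (snd (\<gamma> y) - (snd (\<gamma> t) + (y - t) *\<^sub>R snd D))
        = (1 / (y - t)) *\<^sub>R ((y - t) *\<^sub>R snd D)"
      by (simp only: scaleR_diff_right[symmetric]) simp
    then have "snd D = (1 / (y - t)) *\<^sub>R (snd (\<gamma> y) - snd (\<gamma> t)) - (1 / (y - t)) *\<^sub>R (snd (\<gamma> y) - (snd (\<gamma> t) + (y - t) *\<^sub>R snd D))"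
      using y(2) by simp
    then have "norm (snd D) \<le> norm ((1 / (y - t)) *\<^sub>R (snd (\<gamma> y) - snd (\<gamma> t)))
        + norm ((1 / (y - t)) *\<^sub>R (snd (\<gamma> y) - (snd (\<gamma> t) + (y - t) *\<^sub>R snd D)))"
      by (metis norm_triangle_ineq4)
    also have "norm ((1 / (y - t)) *\<^sub>R (snd (\<gamma> y) - (snd (\<gamma> t) + (y - t) *\<^sub>R snd D))) = norm (snd (R y))"
      by (simp add: R_def)
    also have "norm ((1 / (y - t)) *\<^sub>R (snd (\<gamma> y) - snd (\<gamma> t))) \<le> ?L * norm (fst (R y))"
      using divide_right_mono[OF lip[OF y(1)], of "\<bar>y - t\<bar>"] D0 by (simp add: R_def)
    finally show ?thesis by simp
  qed
  have "norm (snd D) \<le> norm (snd (0 :: real \<times> complex)) + ?L * norm (fst (0 :: real \<times> complex))"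
  proof (rule tendsto_lowerbound)
    show "((\<lambda>y. norm (snd (R y)) + ?L * norm (fst (R y))) \<longlongrightarrow>
        norm (snd (0 :: real \<times> complex)) + ?L * norm (fst (0 :: real \<times> complex))) (at t within {0..1})"
      by (intro tendsto_intros R)
    show "\<forall>\<^sub>F y in at t within {0..1}. norm (snd D) \<le> norm (snd (R y)) + ?L * norm (fst (R y))"
      using bound by (auto simp: eventually_at_filter)
    show "at t within {0..1} \<noteq> bot"
      using t by (simp add: trivial_limit_within islimpt_Icc)
  qed
  then have "D = 0" using D0 by (simp add: prod_eq_iff)
  moreover have "D \<noteq> 0"
    using \<gamma>(1) t vector_derivative_at[OF D] by (auto simp: regular_arc_def)
  ultimately show False by simp
qed

text \<open>The projection of the arc has a derivative bounded away from 0, so its inverse is Lipschitz and preserves null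
sets.\<close>
lemma arc_projection_null:
  assumes \<gamma>: "regular_arc \<gamma>" "path_image \<gamma> \<subseteq> X" and E: "E \<in> null_sets lborel"
  shows "{t \<in> {0..1}. fst (\<gamma> t) \<in> E} \<in> null_sets lborel"
proof -
  obtain D where D: "\<And>t. t \<in> {0..1} \<Longrightarrow> (\<gamma> has_vector_derivative D t) (at t)" "continuous_on {0..1} D"
    using \<gamma>(1) unfolding regular_arc_def C1_differentiable_on_def by blast
  let ?\<phi> = "\<lambda>t. fst (\<gamma> t)" and ?P = "{t \<in> {0..1}. fst (\<gamma> t) \<in> E}"
  have deriv: "(?\<phi> has_real_derivative fst (D t)) (at t)" if "t \<in> {0..1}" for t
    using bounded_linear.has_vector_derivative[OF bounded_linear_fst D(1)[OF that]]
    by (simp add: has_real_derivative_iff_has_vector_derivative)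
  have "continuous_on {0..1} (\<lambda>t. \<bar>fst (D t)\<bar>)" by (intro continuous_intros D(2))
  then obtain t0 where t0: "t0 \<in> {0..1}" "\<And>t. t \<in> {0..1} \<Longrightarrow> \<bar>fst (D t0)\<bar> \<le> \<bar>fst (D t)\<bar>"
    using continuous_attains_inf[of "{0..1::real}" "\<lambda>t. \<bar>fst (D t)\<bar>"] by auto
  define c where "c = \<bar>fst (D t0)\<bar>"
  have c: "0 < c" using regular_arc_transversal[OF \<gamma> t0(1) D(1)[OF t0(1)]] by (simp add: c_def)
  have exp': "c * (t - s) \<le> \<bar>?\<phi> t - ?\<phi> s\<bar>" if st: "s \<in> {0..1}" "t \<in> {0..1}" "s < t" for s t
  proof -
    have "\<exists>z. s < z \<and> z < t \<and> ?\<phi> t - ?\<phi> s = (t - s) * fst (D z)"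
      using st by (intro MVT2 deriv) auto
    then obtain z where z: "s < z" "z < t" "?\<phi> t - ?\<phi> s = (t - s) * fst (D z)" by blast
    have "c \<le> \<bar>fst (D z)\<bar>" using t0(2)[of z] z st by (simp add: c_def)
    then show ?thesis using z(3) st mult_right_mono[of c "\<bar>fst (D z)\<bar>" "t - s"] by (simp add: abs_mult mult.commute)
  qed
  have expand: "c * \<bar>t - s\<bar> \<le> \<bar>?\<phi> t - ?\<phi> s\<bar>" if "s \<in> {0..1}" "t \<in> {0..1}" for s t
    using exp'[of s t] exp'[of t s] that by (cases s t rule: linorder_cases) (auto simp: abs_minus_commute)
  have inj: "inj_on ?\<phi> {0..1}"
  proof (rule inj_onI)
    fix s t assume "s \<in> {0..1}" "t \<in> {0..1}" "?\<phi> s = ?\<phi> t"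
    then have "c * \<bar>t - s\<bar> \<le> 0" using expand[of s t] by simp
    then show "s = t" using c by (simp add: mult_le_0_iff)
  qed
  let ?\<iota> = "the_inv_into {0..1} ?\<phi>"
  have \<iota>: "?\<iota> (?\<phi> t) = t" if "t \<in> {0..1}" for t using inj that by (rule the_inv_into_f_f)
  have "negligible (?\<iota> ` (?\<phi> ` ?P))"
  proof (rule negligible_locally_Lipschitz_image)
    have "E \<in> null_sets lebesgue" using E by (rule null_sets_completionI)
    then have "negligible E" by (simp add: negligible_iff_null_sets)
    then show "negligible (?\<phi> ` ?P)" by (rule negligible_subset) auto
    fix x assume "x \<in> ?\<phi> ` ?P"
    then obtain s where s: "s \<in> {0..1}" "x = ?\<phi> s" by auto
    have "norm (?\<iota> y - ?\<iota> x) \<le> 1 / c * norm (y - x)" if y: "y \<in> ?\<phi> ` ?P" for y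
    proof -
      obtain t where t: "t \<in> {0..1}" "y = ?\<phi> t" using y by auto
      show ?thesis using expand[OF s(1) t(1)] c \<iota> s t by (simp add: field_simps)
    qed
    then show "\<exists>T B. open T \<and> x \<in> T \<and> (\<forall>y\<in>?\<phi> ` ?P \<inter> T. norm (?\<iota> y - ?\<iota> x) \<le> B * norm (y - x))"
      by (intro exI[of _ UNIV] exI[of _ "1 / c"]) auto
  qed simp
  also have "?\<iota> ` (?\<phi> ` ?P) = ?P" using \<iota> by (force simp: image_image)
  finally have "?P \<in> null_sets lebesgue" by (simp add: negligible_iff_null_sets)
  moreover have "?P \<in> sets lborel"
  proof -
    have "continuous_on {0..1} ?\<phi>"
      using deriv by (intro continuous_at_imp_continuous_on ballI DERIV_isCont)
    then have "?\<phi> \<in> borel_measurable (restrict_space borel {0..1})"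
      by (rule borel_measurable_continuous_on_restrict)
    from measurable_sets[OF this, of E] E
    have "?\<phi> -` E \<inter> {0..1} \<in> sets (restrict_space borel {0..1})" by (auto simp: space_restrict_space)
    then have "?\<phi> -` E \<inter> {0..1} \<in> sets borel" by (simp add: sets_restrict_space_iff)
    moreover have "?\<phi> -` E \<inter> {0..1} = ?P" by auto
    ultimately show ?thesis by simp
  qed
  ultimately show ?thesis by (simp add: null_sets_completion_iff)
qed

lemma fibre_leaf_null:
  assumes E: "E \<in> null_sets lborel" and W: "W \<subseteq> X"
  shows "fst -` E \<inter> X \<in> leaf_null_sets X W"
proof -
  have fst_borel: "fst \<in> borel_measurable (borel :: (real \<times> complex) measure)"
    by (intro borel_measurable_continuous_onI continuous_on_fst continuous_on_id)
  have A: "fst -` E \<inter> X \<in> sets (restrict_space borel X)"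
    unfolding sets_restrict_space
    by (rule image_eqI[of _ _ "fst -` E"]) (use measurable_sets[OF fst_borel, of E] E in \<open>auto simp: null_sets_def\<close>)
  have "fst -` E \<inter> X \<in> null_sets (arc_length_measure X \<gamma>)"
    if \<gamma>: "regular_arc \<gamma>" "path_image \<gamma> \<subseteq> W" for \<gamma>
  proof -
    let ?N = "restrict_space lborel {0..1::real}"
    let ?h = "\<lambda>t. ennreal (norm (vector_derivative \<gamma> (at t)))"
    have \<gamma>X: "path_image \<gamma> \<subseteq> X" using \<gamma>(2) W by blast
    obtain D where D: "\<And>t. t \<in> {0..1} \<Longrightarrow> (\<gamma> has_vector_derivative D t) (at t)" "continuous_on {0..1} D"
      using \<gamma>(1) unfolding regular_arc_def C1_differentiable_on_def by blast
    have sN: "sets ?N = sets (restrict_space borel {0..1})" by (rule sets_restrict_space_cong) simp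
    have "continuous_on {0..1} (\<lambda>t. norm (D t))" by (intro continuous_intros D(2))
    then have "continuous_on {0..1} (\<lambda>t. norm (vector_derivative \<gamma> (at t)))"
      by (rule continuous_on_eq) (simp add: vector_derivative_at[OF D(1)])
    from borel_measurable_continuous_on_restrict[OF this]
    have h: "?h \<in> borel_measurable ?N"
      by (subst measurable_cong_sets[OF sN refl]) (rule measurable_compose[OF _ measurable_ennreal])
    have "continuous_on {0..1} \<gamma>"
      using \<gamma>(1) by (simp add: regular_arc_def arc_def path_def)
    then have "\<gamma> \<in> borel_measurable (restrict_space borel {0..1})"
      by (rule borel_measurable_continuous_on_restrict)
    then have "\<gamma> \<in> restrict_space borel {0..1} \<rightarrow>\<^sub>M restrict_space borel X"
      using \<gamma>X by (intro measurable_restrict_space2) (auto simp: space_restrict_space path_image_def)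
    then have meas: "\<gamma> \<in> density ?N ?h \<rightarrow>\<^sub>M restrict_space borel X"
      using sN by (simp cong: measurable_cong_sets)
    have "{t \<in> {0..1}. fst (\<gamma> t) \<in> E} \<in> null_sets ?N"
      using arc_projection_null[OF \<gamma>(1) \<gamma>X E] by (subst null_sets_restrict_space) auto
    then have null: "{t \<in> {0..1}. fst (\<gamma> t) \<in> E} \<in> null_sets (density ?N ?h)"
      using absolutely_continuousI_density[OF h] by (auto simp: absolutely_continuous_def)
    have "\<gamma> -` (fst -` E \<inter> X) \<inter> space (density ?N ?h) = {t \<in> {0..1}. fst (\<gamma> t) \<in> E}"
    proof -
      have "\<gamma> t \<in> X" if "t \<in> {0..1}" for t using \<gamma>X that unfolding path_image_def by blast
      then show ?thesis by (auto simp: space_restrict_space)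
    qed
    then have "emeasure (arc_length_measure X \<gamma>) (fst -` E \<inter> X) = 0"
      unfolding arc_length_measure_def using null by (simp add: emeasure_distr[OF meas A] null_setsD1)
    then show ?thesis using A by (auto simp: null_sets_def arc_length_measure_def)
  qed
  then show ?thesis using A unfolding leaf_null_sets_def by blast
qed

section \<open>Projection of SRB measures to the interval\<close>
lemma attractor_in_domain: "p \<in> X \<Longrightarrow> 0 \<le> fst p \<and> fst p \<le> 1 \<and> norm (snd p) \<le> 1"
proof -
  assume "p \<in> X"
  then have "p \<in> (F ^^ 0) ` solenoid_domain" unfolding attractor_def by blast
  then show ?thesis by (auto simp: solenoid_domain_def)
qed

lemma F_attractor: "p \<in> X \<Longrightarrow> F p \<in> X"
proof -
  assume p: "p \<in> X"
  have "F p \<in> (F ^^ i) ` solenoid_domain" for i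
  proof (cases i)
    case 0
    obtain x z where xz: "p = (x, z)" "0 \<le> x" "x \<le> 1" "norm z \<le> 1" using attractor_in_domain[OF p] by (cases p) auto
    have "norm (of_real \<theta> * z + circle x) \<le> \<theta> * norm z + 1/2"
      using theta_pos norm_triangle_ineq[of "of_real \<theta> * z" "circle x"]
      by (simp add: norm_mult norm_circle)
    also have "\<theta> * norm z \<le> \<theta> * 1" using xz theta_pos by (intro mult_left_mono) auto
    finally have "norm (of_real \<theta> * z + circle x) \<le> \<theta> * 1 + 1/2" by simp
    then show ?thesis using xz theta_less g_unit[of x] 0 by (simp add: F_eq solenoid_domain_def)
  next
    case (Suc j)
    have "p \<in> (F ^^ j) ` solenoid_domain" using p unfolding attractor_def by blast
    then show ?thesis using Suc by (auto simp: image_iff)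
  qed
  then show ?thesis unfolding attractor_def by blast
qed

lemma F_funpow_attractor: "p \<in> X \<Longrightarrow> (F ^^ n) p \<in> X"
  by (induction n) (auto simp: F_attractor)

lemma srb_projection:
  assumes "srb_measure F X \<mu>"
  shows "intermittent_acip \<alpha> (distr \<mu> borel fst)"
proof -
  let ?\<nu> = "distr \<mu> borel fst :: real measure"
  have sets: "sets \<mu> = sets (restrict_space borel X)" and prob: "prob_space \<mu>"
    and F_meas: "F \<in> \<mu> \<rightarrow>\<^sub>M \<mu>" and F_inv: "distr \<mu> \<mu> F = \<mu>"
    using assms unfolding srb_measure_def by auto
  obtain \<xi> \<kappa> where "conditional_measures \<mu> \<xi> \<kappa>"
    and null: "AE p in \<mu>. leaf_null_sets X (unstable_manifold F X p) \<subseteq> null_sets (\<kappa> p)"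
    using assms unfolding srb_measure_def by blast
  then have \<kappa>: "\<kappa> \<in> \<mu> \<rightarrow>\<^sub>M prob_algebra \<mu>" "\<mu> \<bind> \<kappa> = \<mu>"
    unfolding conditional_measures_def by auto
  have space: "space \<mu> = X" using sets_eq_imp_space_eq[OF sets] by (simp add: space_restrict_space)
  have fst_borel: "fst \<in> borel_measurable (borel :: (real \<times> complex) measure)"
    by (intro borel_measurable_continuous_onI continuous_on_fst continuous_on_id)
  have fst_meas: "fst \<in> borel_measurable \<mu>"
    using measurable_restrict_space1[OF fst_borel, of X] by (simp cong: measurable_cong_sets add: sets)
  interpret \<mu>: prob_space \<mu> by (rule prob)
  have distr: "measure ?\<nu> B = measure \<mu> (fst -` B \<inter> X)" if "B \<in> sets borel" for B
    using measure_distr[OF fst_meas that] by (simp add: space)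
  have ac: "absolutely_continuous lborel ?\<nu>"
    unfolding absolutely_continuous_def
  proof
    fix E assume E: "E \<in> null_sets (lborel :: real measure)"
    let ?A = "fst -` E \<inter> X"
    have E_borel: "E \<in> sets borel" using E by (simp add: null_sets_def)
    then have A: "?A \<in> sets \<mu>" using measurable_sets[OF fst_meas, of E] by (simp add: space)
    have "AE p in \<mu>. emeasure (\<kappa> p) ?A = 0"
      using null
    proof eventually_elim
      case (elim p)
      have "unstable_manifold F X p \<subseteq> X"
      proof
        fix q assume "q \<in> unstable_manifold F X p"
        then obtain Q where "Q 0 = q" "\<forall>n. Q n \<in> X \<and> F (Q (Suc n)) = Q n"
          unfolding unstable_manifold_def by blast
        then show "q \<in> X" by metis
      qed
      then have "?A \<in> null_sets (\<kappa> p)" using fibre_leaf_null[OF E] elim by blast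
      then show ?case by (rule null_setsD1)
    qed
    then have "(\<integral>\<^sup>+p. emeasure (\<kappa> p) ?A \<partial>\<mu>) = (\<integral>\<^sup>+p. 0 \<partial>\<mu>)" by (rule nn_integral_cong_AE)
    moreover have "emeasure (\<mu> \<bind> \<kappa>) ?A = (\<integral>\<^sup>+p. emeasure (\<kappa> p) ?A \<partial>\<mu>)"
      using \<mu>.not_empty measurable_prob_algebraD[OF \<kappa>(1)] A by (rule emeasure_bind)
    ultimately have "emeasure \<mu> ?A = 0" using \<kappa>(2) by simp
    then show "E \<in> null_sets ?\<nu>"
      using E_borel by (simp add: null_sets_def emeasure_distr[OF fst_meas] space)
  qed
  show ?thesis
  proof (intro intermittent_acip.intro intermittent_acip_axioms.intro ac)
    show "intermittent_map \<alpha>" by (rule intermittent_map_axioms)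
    show "prob_space ?\<nu>" using fst_meas by (rule \<mu>.prob_space_distr)
    have "fst -` (- {0..1}) \<inter> X = {}" using attractor_in_domain by auto
    then show "measure ?\<nu> (- {0..1}) = 0" by (subst distr) auto
    fix B :: "real set" assume B: "B \<in> sets borel"
    then have A: "fst -` B \<inter> X \<in> sets \<mu>" using measurable_sets[OF fst_meas, of B] by (simp add: space)
    have gB: "g -` B \<in> sets borel" using measurable_sets[OF g_measurable B] by simp
    have "measure ?\<nu> B = measure (distr \<mu> \<mu> F) (fst -` B \<inter> X)" using distr[OF B] F_inv by simp
    also have "\<dots> = measure \<mu> (F -` (fst -` B \<inter> X) \<inter> X)"
      using measure_distr[OF F_meas A] by (simp add: space)
    also have "F -` (fst -` B \<inter> X) \<inter> X = fst -` (g -` B) \<inter> X"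
      using F_attractor by (auto simp: F_eq)
    also have "measure \<mu> \<dots> = measure ?\<nu> (g -` B)" using distr[OF gB] by simp
    finally show "measure ?\<nu> (g -` B) = measure ?\<nu> B" by simp
  qed simp
qed

end

section \<open>Holes of the solenoid map\<close>

lemma less_hitting_time_iff: "enat n < hitting_time f H p \<longleftrightarrow> (\<forall>k. 1 \<le> k \<and> k \<le> n \<longrightarrow> (f ^^ k) p \<notin> H)"
proof
  assume less: "enat n < hitting_time f H p"
  show "\<forall>k. 1 \<le> k \<and> k \<le> n \<longrightarrow> (f ^^ k) p \<notin> H"
  proof (intro allI impI notI)
    fix k assume k: "1 \<le> k \<and> k \<le> n" "(f ^^ k) p \<in> H"
    then have "hitting_time f H p \<le> enat k" unfolding hitting_time_def by (intro Inf_lower) auto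
    also have "\<dots> \<le> enat n" using k by simp
    finally show False using less by simp
  qed
next
  assume avoid: "\<forall>k. 1 \<le> k \<and> k \<le> n \<longrightarrow> (f ^^ k) p \<notin> H"
  have "enat (Suc n) \<le> hitting_time f H p"
    unfolding hitting_time_def
  proof (rule Inf_greatest)
    fix x assume "x \<in> {enat n |n. 1 \<le> n \<and> (f ^^ n) p \<in> H}"
    then obtain k where "x = enat k" "1 \<le> k" "(f ^^ k) p \<in> H" by auto
    with avoid show "enat (Suc n) \<le> x" by (cases "k \<le> n") auto
  qed
  then show "enat n < hitting_time f H p" by (rule less_le_trans[rotated]) simp
qed

context solenoid_map
begin

lemma survivors_measurable:
  assumes "F \<in> \<mu> \<rightarrow>\<^sub>M \<mu>" "space \<mu> = X" "H \<in> sets \<mu>"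
  shows "{p \<in> X. hitting_time F H p > enat n} \<in> sets \<mu>"
proof -
  have "F ^^ k \<in> \<mu> \<rightarrow>\<^sub>M \<mu>" for k
    using assms(1) by (induction k) (auto simp: measurable_comp id_def)
  then have "(F ^^ k) -` H \<inter> X \<in> sets \<mu>" for k
    using measurable_sets[OF _ assms(3), of "F ^^ k" \<mu>] assms(2) by simp
  then have "X - (\<Union>k\<in>{1..n}. (F ^^ k) -` H \<inter> X) \<in> sets \<mu>"
    using sets.top[of \<mu>] assms(2) by (intro sets.Diff sets.finite_UN) auto
  also have "X - (\<Union>k\<in>{1..n}. (F ^^ k) -` H \<inter> X) = {p \<in> X. hitting_time F H p > enat n}"
    by (auto simp: less_hitting_time_iff)
  finally show ?thesis .
qed

lemma hole_away_from_zero: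
  assumes H: "H \<subseteq> X" and away: "({0} \<times> cball 0 1) \<inter> closure H = {}"
  obtains m where "\<And>p. p \<in> H \<Longrightarrow> left_preimage m < fst p"
proof (cases "H = {}")
  case False
  have "H \<subseteq> {0..1} \<times> cball 0 1" using H attractor_in_domain by (auto simp: mem_Times_iff)
  then have cl: "closure H \<subseteq> {0..1} \<times> cball 0 1"
    by (rule closure_minimal) (auto intro: closed_Times)
  have "compact ({0..1::real} \<times> cball (0::complex) 1)" by (intro compact_Times) auto
  then have "compact (closure H)"
    using closed_Int_compact[OF closed_closure, of _ H] cl by (metis inf.absorb1)
  moreover have "closure H \<noteq> {}" using False by simp
  moreover have "continuous_on (closure H) fst" by (intro continuous_on_fst continuous_on_id)
  ultimately obtain q where q: "q \<in> closure H" "\<And>p. p \<in> closure H \<Longrightarrow> fst q \<le> fst p"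
    using continuous_attains_inf[of "closure H" fst] by auto
  have "fst q \<noteq> 0"
  proof
    assume "fst q = 0"
    then have "q \<in> {0} \<times> cball 0 1" using q(1) cl by (auto simp: mem_Times_iff)
    then show False using away q(1) by blast
  qed
  moreover have "0 \<le> fst q" using q(1) cl by (auto simp: mem_Times_iff)
  ultimately have "0 < fst q" by simp
  then obtain m where "left_preimage m < fst q"
    using order_tendstoD(2)[OF left_preimage_tendsto_0] by (auto simp: eventually_sequentially)
  then have "left_preimage m < fst p" if "p \<in> H" for p
    using q(2)[of p] closure_subset[of H] that by fastforce
  then show thesis by (rule that)
qed (rule that, simp)

text \<open>Let p be a point in the interior of the hole and y the first coordinate of a preimage of p of a high
order m. The m-th iterate sends the points of the attractor over the cylinder of y of rank m to the tube that
contains p, and refining the cylinder by N letters brings the first coordinates of the images close to that of p.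
One more letter at the front, for which the exponent Suc m accounts, makes the cylinder a subset of Y.\<close>
lemma hole_contains_cylinder_image:
  assumes int: "(top_of_set X) interior_of H \<noteq> {}"
  obtains m ws where
    "\<And>p. p \<in> X \<Longrightarrow> fst p \<in> word_inverse (True # ws) ` {0<..1} \<Longrightarrow> (F ^^ Suc m) p \<in> H"
proof -
  obtain U p where U: "openin (top_of_set X) U" "p \<in> U" "U \<subseteq> H"
    using int unfolding interior_of_def by blast
  then obtain U' where U': "open U'" "U = X \<inter> U'" by (auto simp: openin_open)
  then obtain e where e: "0 < e" "ball p e \<subseteq> U'" using U(2) by (meson IntD2 openE)
  have pX: "p \<in> X" using U(2) U'(2) by blast
  let ?L = "pi / (1 - \<theta>)"
  have L: "0 \<le> ?L" using theta_less by simp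
  have "(\<lambda>m. 2 * \<theta> ^ m) \<longlonglongrightarrow> 2 * 0"
    using theta_pos theta_less by (intro tendsto_intros LIMSEQ_power_zero) auto
  then obtain m where m: "2 * \<theta> ^ m < e / 2"
    using order_tendstoD(2)[of "\<lambda>m. 2 * \<theta> ^ m" 0 sequentially "e / 2"] e(1)
    by (auto simp: eventually_sequentially)
  have "(\<lambda>N. left_preimage N * (1 + ?L)) \<longlonglongrightarrow> 0 * (1 + ?L)"
    by (intro tendsto_intros left_preimage_tendsto_0)
  then obtain N where N: "left_preimage N * (1 + ?L) < e / 2"
    using order_tendstoD(2)[of "\<lambda>N. left_preimage N * (1 + ?L)" 0 sequentially "e / 2"] e(1)
    by (auto simp: eventually_sequentially)
  have "p \<in> (F ^^ m) ` solenoid_domain" using pX unfolding attractor_def by blast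
  then obtain y \<zeta> where y: "0 \<le> y" "y \<le> 1" "norm \<zeta> \<le> 1" "p = (F ^^ m) (y, \<zeta>)"
    by (auto simp: solenoid_domain_def)
  define w where "w = itinerary m y"
  define x where "x = (g ^^ m) y"
  define v where "v = itinerary N x"
  have x: "0 \<le> x" "x \<le> 1" using g_funpow_unit[OF y(1,2)] by (auto simp: x_def)
  have p: "p = (x, of_real (\<theta> ^ m) * \<zeta> + centre w x)"
    unfolding y(4) F_funpow[OF y(1,2)] x_def w_def ..
  show thesis
  proof (rule that[of "w @ v" m])
    fix q assume q: "q \<in> X" "fst q \<in> word_inverse (True # w @ v) ` {0<..1}"
    then obtain s where s: "0 < s" "s \<le> 1" "fst q = word_inverse (True # w @ v) s" by auto
    define r where "r = word_inverse v s"
    have r: "0 < r" "r \<le> 1" using s word_inverse_pos word_inverse_le_1 by (auto simp: r_def)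
    have gq: "g (fst q) = word_inverse w r"
      using s g_branch_inverse(1)[of "word_inverse (w @ v) s" True] word_inverse_pos[of s "w @ v"]
        word_inverse_le_1[of s "w @ v"] by (simp add: r_def word_inverse_append)
    obtain \<zeta>' where \<zeta>': "F q = (word_inverse w r, \<zeta>')" using gq by (cases q) (auto simp: F_eq)
    have \<zeta>'1: "norm \<zeta>' \<le> 1" using attractor_in_domain[OF F_attractor[OF q(1)]] \<zeta>' by simp
    have len: "length w = m" by (simp add: w_def)
    have Fq: "(F ^^ Suc m) q = (r, of_real (\<theta> ^ m) * \<zeta>' + centre w r)"
    proof -
      have "(F ^^ Suc m) q = (F ^^ m) (word_inverse w r, \<zeta>')" using \<zeta>' by (simp add: funpow_swap1)
      also have "\<dots> = (r, of_real (\<theta> ^ m) * \<zeta>' + centre w r)"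
        using F_funpow[of "word_inverse w r" m \<zeta>'] itinerary_word_inverse[OF r, of w] len
          word_inverse_nonneg[of r w] word_inverse_le_1[of r w] r by simp
      finally show ?thesis .
    qed
    have rx: "\<bar>r - x\<bar> \<le> left_preimage N"
      using word_inverse_diameter[of s "(g ^^ N) x" v] word_inverse_itinerary[OF x, of N] s
        g_funpow_unit[OF x, of N] by (simp add: r_def v_def)
    have small: "norm (of_real (\<theta> ^ m) * u) \<le> \<theta> ^ m" if "norm u \<le> 1" for u :: complex
      using that theta_pos by (simp add: norm_mult norm_power mult_left_le)
    have "norm ((of_real (\<theta> ^ m) * \<zeta> + centre w x) - (of_real (\<theta> ^ m) * \<zeta>' + centre w r))
      \<le> \<theta> ^ m + \<theta> ^ m + norm (centre w r - centre w x)"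
    proof -
      have eq: "(of_real (\<theta> ^ m) * \<zeta> + centre w x) - (of_real (\<theta> ^ m) * \<zeta>' + centre w r) =
        (of_real (\<theta> ^ m) * \<zeta> - of_real (\<theta> ^ m) * \<zeta>') - (centre w r - centre w x)" by simp
      show ?thesis
        unfolding eq
        using norm_triangle_ineq4[of "of_real (\<theta> ^ m) * \<zeta>" "of_real (\<theta> ^ m) * \<zeta>'"]
          norm_triangle_ineq4[of "of_real (\<theta> ^ m) * \<zeta> - of_real (\<theta> ^ m) * \<zeta>'" "centre w r - centre w x"]
          small[OF y(3)] small[OF \<zeta>'1] by linarith
    qed
    also have "norm (centre w r - centre w x) \<le> ?L * left_preimage N"
      using centre_lipschitz[of r x w] r x rx L by (intro order.trans[OF centre_lipschitz] mult_left_mono) auto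
    finally have snd_close: "norm ((of_real (\<theta> ^ m) * \<zeta> + centre w x) - (of_real (\<theta> ^ m) * \<zeta>' + centre w r))
      \<le> 2 * \<theta> ^ m + ?L * left_preimage N" by simp
    have "dist p ((F ^^ Suc m) q) \<le> \<bar>x - r\<bar>
      + norm ((of_real (\<theta> ^ m) * \<zeta> + centre w x) - (of_real (\<theta> ^ m) * \<zeta>' + centre w r))"
      unfolding p Fq dist_norm
      using norm_Pair_le[of "x - r" "(of_real (\<theta> ^ m) * \<zeta> + centre w x) - (of_real (\<theta> ^ m) * \<zeta>' + centre w r)"]
      by simp
    also have "\<dots> \<le> left_preimage N + (2 * \<theta> ^ m + ?L * left_preimage N)"
      using rx snd_close by (intro add_mono) (auto simp: abs_minus_commute)
    also have "\<dots> < e" using m N unfolding distrib_left by (simp add: mult.commute)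
    finally have "(F ^^ Suc m) q \<in> U'" using e(2) by auto
    then show "(F ^^ Suc m) q \<in> H" using F_funpow_attractor[OF q(1), of "Suc m"] U'(2) U(3) by blast
  qed
qed

text \<open>Survival up to time n contains the fibres over (0, a (m0 + n)], since orbits from there stay below a m0, and
is contained in the fibres over the points that avoid K for n - m - 1 steps, since each visit to K leads to
the hole m + 1 steps later. The shifts of n only change the constants.\<close>
lemma survivor_bounds:
  assumes srb: "srb_measure F X \<mu>" and H: "H \<in> sets \<mu>" "H \<subseteq> X"
    and away: "({0} \<times> cball 0 1) \<inter> closure H = {}"
    and int: "(top_of_set X) interior_of H \<noteq> {}"
  obtains c C where "0 < c" "0 < C"
    "\<And>n. 1 \<le> n \<Longrightarrow> c * real n powr (1 - 1/\<alpha>) \<le> measure \<mu> {p \<in> X. hitting_time F H p > enat n}"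
    "\<And>n. 1 \<le> n \<Longrightarrow> measure \<mu> {p \<in> X. hitting_time F H p > enat n} \<le> C * real n powr (1 - 1/\<alpha>)"
proof -
  let ?\<nu> = "distr \<mu> borel fst" and ?S = "\<lambda>n. {p \<in> X. hitting_time F H p > enat n}"
  define \<rho> where "\<rho> = 1/\<alpha> - 1"
  have \<rho>: "0 < \<rho>" "1 - 1/\<alpha> = - \<rho>" using alpha_pos alpha_less_1 by (auto simp: \<rho>_def)
  interpret \<nu>: intermittent_acip \<alpha> ?\<nu> using srb by (rule srb_projection)
  interpret \<mu>: prob_space \<mu> using srb by (simp add: srb_measure_def)
  have sets: "sets \<mu> = sets (restrict_space borel X)" and F_meas: "F \<in> \<mu> \<rightarrow>\<^sub>M \<mu>"
    using srb unfolding srb_measure_def by auto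
  have space: "space \<mu> = X" using sets_eq_imp_space_eq[OF sets] by (simp add: space_restrict_space)
  have fst_borel: "fst \<in> borel_measurable (borel :: (real \<times> complex) measure)"
    by (intro borel_measurable_continuous_onI continuous_on_fst continuous_on_id)
  have fst_meas: "fst \<in> borel_measurable \<mu>"
    using measurable_restrict_space1[OF fst_borel, of X] by (simp cong: measurable_cong_sets add: sets)
  have distr: "measure ?\<nu> B = measure \<mu> (fst -` B \<inter> X)" "fst -` B \<inter> X \<in> sets \<mu>"
    if "B \<in> sets borel" for B
    using measure_distr[OF fst_meas that] measurable_sets[OF fst_meas that] by (simp_all add: space)
  have S: "?S n \<in> sets \<mu>" for n using survivors_measurable[OF F_meas space H(1)] .

  obtain m0 where m0: "\<And>p. p \<in> H \<Longrightarrow> left_preimage m0 < fst p"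
    by (rule hole_away_from_zero[OF H(2) away]) blast
  obtain c where c: "0 < c" "\<And>n. 1 \<le> n \<Longrightarrow> c * real n powr (1 - 1/\<alpha>) \<le> measure ?\<nu> {0<..left_preimage n}"
    by (rule \<nu>.nu_near_zero_lower) blast
  have lower: "c * real (Suc m0) powr (-\<rho>) * real n powr (-\<rho>) \<le> measure \<mu> (?S n)" if n: "1 \<le> n" for n
  proof -
    have "m0 * 1 \<le> m0 * n" using n by (intro mult_left_mono) auto
    then have "m0 + n \<le> Suc m0 * n" by simp
    then have "real (m0 + n) \<le> real (Suc m0) * real n" by (metis of_nat_le_iff of_nat_mult)
    then have "(real (Suc m0) * real n) powr (-\<rho>) \<le> real (m0 + n) powr (-\<rho>)"
      using \<rho> n by (intro powr_mono2') auto
    then have "c * (real (Suc m0) powr (-\<rho>) * real n powr (-\<rho>)) \<le> c * real (m0 + n) powr (-\<rho>)"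
      using c(1) powr_mult[of "real (Suc m0)" "real n" "-\<rho>"] by (intro mult_left_mono) auto
    also have "\<dots> \<le> measure ?\<nu> {0<..left_preimage (m0 + n)}"
      using c(2)[of "m0 + n"] n \<rho>(2) by simp
    also have "\<dots> = measure \<mu> (fst -` {0<..left_preimage (m0 + n)} \<inter> X)" by (rule distr) simp
    also have "\<dots> \<le> measure \<mu> (?S n)"
    proof (rule \<mu>.finite_measure_mono[OF _ S], rule subsetI)
      fix p assume p: "p \<in> fst -` {0<..left_preimage (m0 + n)} \<inter> X"
      have "(F ^^ k) p \<notin> H" if "k \<le> n" for k
      proof
        assume "(F ^^ k) p \<in> H"
        then have "left_preimage m0 < (g ^^ k) (fst p)"
          using m0 fst_F_funpow[of p k] attractor_in_domain[of p] p by fastforce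
        moreover have "(g ^^ k) (fst p) \<le> left_preimage m0"
          using p left_preimage_antimono[of "m0 + k" "m0 + n"] \<open>k \<le> n\<close> by (intro g_funpow_le_left_preimage) auto
        ultimately show False by simp
      qed
      then show "p \<in> ?S n" using p by (auto simp: less_hitting_time_iff)
    qed
    finally show ?thesis by (simp add: mult.assoc)
  qed

  obtain m ws where cyl:
    "\<And>p. p \<in> X \<Longrightarrow> fst p \<in> word_inverse (True # ws) ` {0<..1} \<Longrightarrow> (F ^^ Suc m) p \<in> H"
    by (rule hole_contains_cylinder_image[OF int]) blast
  define K where "K = word_inverse (True # ws) ` {0<..1}"
  have K_borel: "K \<in> sets borel" unfolding K_def by (intro word_inverse_image_borel) auto
  obtain C where C: "0 < C" "\<And>n. 1 \<le> n \<Longrightarrow> measure ?\<nu> (avoids K n) \<le> C * real n powr (1 - 1/\<alpha>)"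
    unfolding K_def by (rule \<nu>.nu_escape_upper[of ws]) blast
  let ?q = "real (m + 2)"
  have upper: "measure \<mu> (?S n) \<le> (C + 1) * ?q powr \<rho> * real n powr (-\<rho>)" if n: "1 \<le> n" for n
  proof (cases "n < m + 2")
    case True
    have "real n powr \<rho> \<le> ?q powr \<rho>" using True \<rho> by (intro powr_mono2) auto
    then have "1 \<le> ?q powr \<rho> * real n powr (-\<rho>)" using n by (simp add: powr_minus field_simps)
    also have "\<dots> \<le> (C + 1) * (?q powr \<rho> * real n powr (-\<rho>))"
      using C(1) by (simp add: distrib_right)
    finally show ?thesis by (intro order.trans[OF \<mu>.prob_le_1]) (simp only: mult.assoc)
  next
    case False
    define k where "k = n - m - 1"
    have k: "n = k + m + 1" "1 \<le> k" using False by (auto simp: k_def)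
    have "measure \<mu> (?S n) \<le> measure \<mu> (fst -` avoids K k \<inter> X)"
    proof (rule \<mu>.finite_measure_mono[OF _ distr(2)], rule subsetI)
      fix p assume p: "p \<in> ?S n"
      have "(g ^^ i) (fst p) \<notin> K" if i: "i \<in> {1..k}" for i
      proof
        assume "(g ^^ i) (fst p) \<in> K"
        then have "fst ((F ^^ i) p) \<in> K" using p attractor_in_domain[of p] fst_F_funpow[of p i] by simp
        then have "(F ^^ Suc m) ((F ^^ i) p) \<in> H"
          using cyl F_funpow_attractor[of p i] p unfolding K_def by blast
        then have "(F ^^ (Suc m + i)) p \<in> H" by (simp add: funpow_add)
        moreover have "1 \<le> Suc m + i" "Suc m + i \<le> n" using i k by auto
        ultimately show False using p by (auto simp: less_hitting_time_iff)
      qed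
      then show "p \<in> fst -` avoids K k \<inter> X" using p by (auto simp: avoids_def)
    qed (rule avoids_borel[OF K_borel])
    also have "\<dots> = measure ?\<nu> (avoids K k)" by (rule distr(1)[symmetric, OF avoids_borel[OF K_borel]])
    also have "\<dots> \<le> C * real k powr (-\<rho>)" using C(2)[OF k(2)] \<rho>(2) by simp
    also have "\<dots> \<le> C * (real n / ?q) powr (-\<rho>)"
    proof -
      have "n = k + (m + 1) * 1" using k(1) by simp
      also have "\<dots> \<le> k + (m + 1) * k" using k(2) by (intro add_left_mono mult_left_mono) auto
      also have "\<dots> = k * (m + 2)" by (simp add: algebra_simps)
      finally have "n \<le> k * (m + 2)" .
      then have "real n \<le> real k * ?q" by (metis of_nat_le_iff of_nat_mult)
      then have "real n / ?q \<le> real k" by (simp add: field_simps)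
      then show ?thesis using C(1) \<rho> n by (intro mult_left_mono powr_mono2') auto
    qed
    also have "\<dots> = C * (?q powr \<rho> * real n powr (-\<rho>))"
      by (simp add: powr_divide powr_minus field_simps)
    also have "\<dots> \<le> (C + 1) * (?q powr \<rho> * real n powr (-\<rho>))"
      by (intro mult_right_mono) auto
    finally show ?thesis by (simp add: mult.assoc)
  qed
  show thesis
  proof (rule that)
    show "0 < c * real (Suc m0) powr (-\<rho>)" "0 < (C + 1) * ?q powr \<rho>" using c(1) C(1) by auto
  qed (use lower upper \<rho>(2) in simp_all)
qed

end

theorem theorem4p1:
  fixes \<alpha> \<theta> :: real and f :: "real \<times> complex \<Rightarrow> real \<times> complex"
    and X H :: "(real \<times> complex) set" and \<mu> :: "(real \<times> complex) measure"
  assumes "0 < \<alpha>" and "\<alpha> < 1"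
    and "0 < \<theta>" and "\<theta> * lsv_deriv_sup \<alpha> < 1 - \<theta>"
    and "f = solenoid \<alpha> \<theta>"
    and "X = attractor f solenoid_domain"
    and "srb_measure f X \<mu>"
    and "H \<in> sets \<mu>" and "H \<subset> X"
    and "0 < measure \<mu> H" and "measure \<mu> H < 1"
    and "({0} \<times> cball 0 1) \<inter> closure H = {}"
    and "(top_of_set X) interior_of H \<noteq> {}"
  shows "\<exists>C::real. 1 \<le> C \<and> (\<forall>n::nat. 1 \<le> n \<longrightarrow>
     real n powr (1 - 1/\<alpha>) / C \<le> measure \<mu> {p \<in> X. hitting_time f H p > enat n} \<and>
     measure \<mu> {p \<in> X. hitting_time f H p > enat n} \<le> C * real n powr (1 - 1/\<alpha>))"
proof -
  interpret intermittent_map \<alpha> using assms(1,2) by unfold_locales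
  have "\<theta> * 2 \<le> \<theta> * lsv_deriv_sup \<alpha>"
    using lsv_deriv_sup_ge_2 assms(3) by (intro mult_left_mono) auto
  then have "\<theta> < 1/3" using assms(4) by linarith
  with assms(3) interpret solenoid_map \<alpha> \<theta> by unfold_locales
  let ?P = "\<lambda>n. measure \<mu> {p \<in> X. hitting_time f H p > enat n}"
  obtain c C where cC: "0 < c" "0 < C"
    "\<And>n. 1 \<le> n \<Longrightarrow> c * real n powr (1 - 1/\<alpha>) \<le> ?P n"
    "\<And>n. 1 \<le> n \<Longrightarrow> ?P n \<le> C * real n powr (1 - 1/\<alpha>)"
    using survivor_bounds[of \<mu> H] assms(5-9,12,13) by auto
  define C' where "C' = max 1 (max (1 / c) C)"
  have C': "1 \<le> C'" "1 / c \<le> C'" "C \<le> C'" by (auto simp: C'_def)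
  have "real n powr (1 - 1/\<alpha>) / C' \<le> ?P n \<and> ?P n \<le> C' * real n powr (1 - 1/\<alpha>)" if n: "1 \<le> n" for n
  proof
    have "1 / C' \<le> c" using C' cC(1) by (simp add: field_simps)
    then have "1 / C' * real n powr (1 - 1/\<alpha>) \<le> c * real n powr (1 - 1/\<alpha>)"
      by (intro mult_right_mono) auto
    then show "real n powr (1 - 1/\<alpha>) / C' \<le> ?P n" using cC(3)[OF n] by simp
    have "C * real n powr (1 - 1/\<alpha>) \<le> C' * real n powr (1 - 1/\<alpha>)"
      using C' by (intro mult_right_mono) auto
    then show "?P n \<le> C' * real n powr (1 - 1/\<alpha>)" using cC(4)[OF n] by simp
  qed
  with C'(1) show ?thesis by blast
qed

end
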